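(* Let $(X_1,d_1)$ and $(X_2,d_2)$ be roughly geodesic, Gromov hyperbolic metric spaces with nonempty boundaries at infinity. For $i=1,2$ let $u_i\in\partial_\infty X_i$, let $\gamma_i:[0,\infty)\to X_i$ be a rough geodesic ray converging to $u_i$, and let $B_i:X_i\to\mathbb{R}$ be the Busemann function associated to $\gamma_i$. For $\Delta\ge 0$ let $$Y_\Delta:=\{(x_1,x_2)\in X_1\times X_2 \;:\; |B_1(x_1)-B_2(x_2)|\le\Delta\}$$ be equipped with the restriction of the metric $d_m\big((x_1,x_2),(x_1',x_2')\big):=\max\{d_1(x_1,x_1'),d_2(x_2,x_2')\}$. Then there exists $\tilde\Delta\ge 0$ such that for all $\Delta\ge\tilde\Delta$ the space $(Y_\Delta,d_m|_{Y_\Delta\times Y_\Delta})$ is roughly geodesic and Gromov hyperbolic. Moreover, $\partial_\infty(Y_\Delta,d_m|_{Y_\Delta\times Y_\Delta})$ is naturally homeomorphic to the smashed product $\partial_\infty(X_1,d_1)\wedge\partial_\infty(X_2,d_2)$ of the pointed spaces $(\partial_\infty X_1,u_1)$ and $(\partial_\infty X_2,u_2)$. Here the natural map sends a class $[\{(x_1^i,x_2^i)\}_i]$ to the image of $(v_1,v_2)$ if, for both $j=1,2$, the sequence $\{x_j^i\}_i$ converges to infinity and represents a point $v_j\neq u_j$ of $\partial_\infty X_j$, and to the collapsed point otherwise.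
   Context: Gromov hyperbolicity: a metric space $(X,d)$ is $\delta$-hyperbolic ($\delta\ge 0$) if for all $x,y,z,w\in X$: $d(x,y)+d(z,w)\le \max\{d(x,z)+d(y,w),d(x,w)+d(y,z)\}+2\delta$; it is Gromov hyperbolic if it is $\delta$-hyperbolic for some $\delta\ge 0$. Rough geodesics: for $k\ge 0$, a $k$-rough geodesic connecting $x$ to $x'$ in $X$ is a (not necessarily continuous) map $\gamma:[\alpha,\omega]\to X$ with $|s-t|-k\le d(\gamma(s),\gamma(t))\le|s-t|+k$ for all $s,t$, and $\gamma(\alpha)=x$, $\gamma(\omega)=x'$. $(X,d)$ is roughly geodesic if there is $k\ge 0$ such that any two points are connected by a $k$-rough geodesic. Boundary at infinity: let $(X,d)$ be Gromov hyperbolic, $z\in X$ a basepoint, and $(x\cdot y)_z:=\frac12[d(x,z)+d(y,z)-d(x,y)]$. A sequence $\{x^i\}$ in $X$ converges to infinity if $\liminf_{i,j\to\infty}(x^i\cdot x^j)_z=\infty$; two such sequences $\{x^i\},\{y^i\}$ are equivalent if $\liminf_{i,j\to\infty}(x^i\cdot y^j)_z=\infty$. $\partial_\infty X=\partial_\infty(X,d)$ is the set of equivalence classes $[\{x^i\}]$, with the topology generated by the sets $$U(v,r):=\{w\in\partial_\infty X : \exists \{x^k\},\{y^k\}\text{ with }[\{x^k\}]=v,\ [\{y^k\}]=w,\ \liminf_{k,l\to\infty}(x^k\cdot y^l)_z>r\},\quad v\in\partial_\infty X,\ r>0.$$ Rays and Busemann functions: a rough geodesic ray is a map $\gamma:[0,\infty)\to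 X$ for which there is $k\ge 0$ with $|s-t|-k\le d(\gamma(s),\gamma(t))\le|s-t|+k$ for all $s,t\ge 0$. It converges to $u\in\partial_\infty X$ if $[\{\gamma(i)\}_{i\in\mathbb{N}}]=u$. The Busemann function associated to $\gamma$ is $B_\gamma(x):=\liminf_{t\to\infty}\big[d(x,\gamma(t))-t\big]$. Smashed product: for pointed topological spaces $(U_1,u_1)$, $(U_2,u_2)$, $U_1\wedge U_2:=(U_1\times U_2)/(U_1\vee U_2)$, where $U_1\vee U_2=(\{u_1\}\times U_2)\cup(U_1\times\{u_2\})\subset U_1\times U_2$; i.e. $U_1\wedge U_2$ is obtained from the product $U_1\times U_2$ by collapsing $U_1\vee U_2$ to a point.
   Formalization: For noncompact boundaries the literal quotient topology makes the claim false; neighbourhoods of the collapsed point must contain the image of A×∂X2 ∪ ∂X1×B (A, B open around u1, u2). For compact boundaries the literal quotient is kept. The sets U(v,r) are read as neighbourhoods of v. *)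

theory Defs
  imports "HOL-Analysis.Analysis"
begin

section \<open>Gromov hyperbolic and roughly geodesic spaces\<close>

text \<open>
  A metric space is a carrier \<open>M\<close> with a distance function \<open>d\<close>, as in the locale
  \<^locale>\<open>Metric_space\<close>. Every definition below looks at \<open>d\<close> on \<open>M\<close> only, so passing to a subset
  with the restricted metric means replacing \<open>M\<close> and keeping \<open>d\<close>.
\<close>

definition gromov_hyperbolic :: "'a set \<Rightarrow> ('a \<Rightarrow> 'a \<Rightarrow> real) \<Rightarrow> bool" where
  "gromov_hyperbolic M d \<longleftrightarrow> (\<exists>\<delta>\<ge>0. \<forall>x\<in>M. \<forall>y\<in>M. \<forall>z\<in>M. \<forall>w\<in>M.
     d x y + d z w \<le> max (d x z + d y w) (d x w + d y z) + 2 * \<delta>)"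

definition rough_isometric_on ::
    "'a set \<Rightarrow> ('a \<Rightarrow> 'a \<Rightarrow> real) \<Rightarrow> real \<Rightarrow> real set \<Rightarrow> (real \<Rightarrow> 'a) \<Rightarrow> bool" where
  "rough_isometric_on M d k I \<gamma> \<longleftrightarrow> \<gamma> ` I \<subseteq> M \<and>
     (\<forall>s\<in>I. \<forall>t\<in>I. \<bar>s - t\<bar> - k \<le> d (\<gamma> s) (\<gamma> t) \<and> d (\<gamma> s) (\<gamma> t) \<le> \<bar>s - t\<bar> + k)"

definition roughly_geodesic :: "'a set \<Rightarrow> ('a \<Rightarrow> 'a \<Rightarrow> real) \<Rightarrow> bool" where
  "roughly_geodesic M d \<longleftrightarrow> (\<exists>k\<ge>0. \<forall>x\<in>M. \<forall>x'\<in>M. \<exists>\<alpha> \<omega> \<gamma>.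
     \<alpha> \<le> \<omega> \<and> rough_isometric_on M d k {\<alpha>..\<omega>} \<gamma> \<and> \<gamma> \<alpha> = x \<and> \<gamma> \<omega> = x')"

definition rough_geodesic_ray :: "'a set \<Rightarrow> ('a \<Rightarrow> 'a \<Rightarrow> real) \<Rightarrow> (real \<Rightarrow> 'a) \<Rightarrow> bool" where
  "rough_geodesic_ray M d \<gamma> \<longleftrightarrow> (\<exists>k\<ge>0. rough_isometric_on M d k {0..} \<gamma>)"

text \<open>
  The lower limit is formed in the extended reals. For a rough geodesic ray with constant \<open>k\<close> it is
  finite, because \<open>\<bar>d x (\<gamma> t) - t\<bar> \<le> d x (\<gamma> 0) + k\<close> for \<open>t \<ge> 0\<close>.
\<close>

definition busemann :: "('a \<Rightarrow> 'a \<Rightarrow> real) \<Rightarrow> (real \<Rightarrow> 'a) \<Rightarrow> 'a \<Rightarrow> real" where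
  "busemann d \<gamma> x = real_of_ereal (Liminf at_top (\<lambda>t. ereal (d x (\<gamma> t) - t)))"


section \<open>The boundary at infinity\<close>

definition gromov_product :: "('a \<Rightarrow> 'a \<Rightarrow> real) \<Rightarrow> 'a \<Rightarrow> 'a \<Rightarrow> 'a \<Rightarrow> real" where
  "gromov_product d z x y = (d x z + d y z - d x y) / 2"

text \<open>The lower limit as both indices tend to infinity independently of each other.\<close>

definition liminf_gromov_product ::
    "('a \<Rightarrow> 'a \<Rightarrow> real) \<Rightarrow> 'a \<Rightarrow> (nat \<Rightarrow> 'a) \<Rightarrow> (nat \<Rightarrow> 'a) \<Rightarrow> ereal" where
  "liminf_gromov_product d z x y =
     Liminf (sequentially \<times>\<^sub>F sequentially) (\<lambda>(i, j). ereal (gromov_product d z (x i) (y j)))"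

definition converges_to_infinity ::
    "'a set \<Rightarrow> ('a \<Rightarrow> 'a \<Rightarrow> real) \<Rightarrow> 'a \<Rightarrow> (nat \<Rightarrow> 'a) \<Rightarrow> bool" where
  "converges_to_infinity M d z x \<longleftrightarrow> range x \<subseteq> M \<and> liminf_gromov_product d z x x = \<infinity>"

definition boundary_rel ::
    "'a set \<Rightarrow> ('a \<Rightarrow> 'a \<Rightarrow> real) \<Rightarrow> 'a \<Rightarrow> ((nat \<Rightarrow> 'a) \<times> (nat \<Rightarrow> 'a)) set" where
  "boundary_rel M d z = {(x, y). converges_to_infinity M d z x \<and> converges_to_infinity M d z y \<and>
     liminf_gromov_product d z x y = \<infinity>}"

definition boundary :: "'a set \<Rightarrow> ('a \<Rightarrow> 'a \<Rightarrow> real) \<Rightarrow> 'a \<Rightarrow> (nat \<Rightarrow> 'a) set set" where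
  "boundary M d z = {x. converges_to_infinity M d z x} // boundary_rel M d z"

definition boundary_class ::
    "'a set \<Rightarrow> ('a \<Rightarrow> 'a \<Rightarrow> real) \<Rightarrow> 'a \<Rightarrow> (nat \<Rightarrow> 'a) \<Rightarrow> (nat \<Rightarrow> 'a) set" where
  "boundary_class M d z x = boundary_rel M d z `` {x}"

definition represents ::
    "'a set \<Rightarrow> ('a \<Rightarrow> 'a \<Rightarrow> real) \<Rightarrow> 'a \<Rightarrow> (nat \<Rightarrow> 'a) \<Rightarrow> (nat \<Rightarrow> 'a) set \<Rightarrow> bool" where
  "represents M d z x v \<longleftrightarrow> converges_to_infinity M d z x \<and> boundary_class M d z x = v"

definition ray_converges_to ::
    "'a set \<Rightarrow> ('a \<Rightarrow> 'a \<Rightarrow> real) \<Rightarrow> 'a \<Rightarrow> (real \<Rightarrow> 'a) \<Rightarrow> (nat \<Rightarrow> 'a) set \<Rightarrow> bool" where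
  "ray_converges_to M d z \<gamma> u \<longleftrightarrow> represents M d z (\<lambda>i. \<gamma> (real i)) u"

definition boundary_nhd ::
    "'a set \<Rightarrow> ('a \<Rightarrow> 'a \<Rightarrow> real) \<Rightarrow> 'a \<Rightarrow> (nat \<Rightarrow> 'a) set \<Rightarrow> real \<Rightarrow> (nat \<Rightarrow> 'a) set set" where
  "boundary_nhd M d z v r = {w \<in> boundary M d z.
     \<exists>x y. represents M d z x v \<and> represents M d z y w \<and> liminf_gromov_product d z x y > ereal r}"

text \<open>
  The sets \<open>boundary_nhd M d z v r\<close>, \<open>r > 0\<close>, serve as basic neighbourhoods of their centre \<open>v\<close>,
  like balls in a metric space. They are not declared open: in a hyperbolic space such a set need
  not be a neighbourhood of its other points, and taking all of them as a subbase can give a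
  topology that depends on the choice of basepoint.
\<close>

definition boundary_topology ::
    "'a set \<Rightarrow> ('a \<Rightarrow> 'a \<Rightarrow> real) \<Rightarrow> 'a \<Rightarrow> (nat \<Rightarrow> 'a) set topology" where
  "boundary_topology M d z = topology (\<lambda>W. W \<subseteq> boundary M d z \<and>
     (\<forall>v\<in>W. \<exists>r>0. boundary_nhd M d z v r \<subseteq> W))"

lemma boundary_nhd_antimono:
  assumes "r \<le> s"
  shows "boundary_nhd M d z v s \<subseteq> boundary_nhd M d z v r"
proof -
  have "ereal r < l" if "ereal s < l" for l
    using that by (rule le_less_trans[rotated]) (simp add: assms)
  then show ?thesis
    unfolding boundary_nhd_def by blast
qed

lemma openin_boundary_topology:
  "openin (boundary_topology M d z) W \<longleftrightarrow> W \<subseteq> boundary M d z \<and>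
     (\<forall>v\<in>W. \<exists>r>0. boundary_nhd M d z v r \<subseteq> W)"
proof -
  let ?P = "\<lambda>W. W \<subseteq> boundary M d z \<and> (\<forall>v\<in>W. \<exists>r>0. boundary_nhd M d z v r \<subseteq> W)"
  have "?P (S \<inter> T)" if S: "?P S" and T: "?P T" for S T
  proof (intro conjI ballI)
    show "S \<inter> T \<subseteq> boundary M d z" using S by blast
    fix v assume v: "v \<in> S \<inter> T"
    obtain r where r: "r > 0" "boundary_nhd M d z v r \<subseteq> S" using S v by blast
    obtain s where s: "s > 0" "boundary_nhd M d z v s \<subseteq> T" using T v by blast
    have "boundary_nhd M d z v (max r s) \<subseteq> S \<inter> T"
      using r s boundary_nhd_antimono[of r "max r s" M d z v]
        boundary_nhd_antimono[of s "max r s" M d z v] by auto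
    then show "\<exists>r>0. boundary_nhd M d z v r \<subseteq> S \<inter> T"
      using r(1) by (intro exI[of _ "max r s"]) auto
  qed
  moreover have "?P (\<Union>K)" if K: "\<forall>S\<in>K. ?P S" for K
  proof (intro conjI ballI)
    show "\<Union>K \<subseteq> boundary M d z" using K by blast
    fix v assume "v \<in> \<Union>K"
    then obtain S where S: "S \<in> K" "v \<in> S" by blast
    then obtain r where "r > 0" "boundary_nhd M d z v r \<subseteq> S" using K by meson
    then show "\<exists>r>0. boundary_nhd M d z v r \<subseteq> \<Union>K" using S(1) by blast
  qed
  ultimately have "istopology ?P"
    unfolding istopology_def by blast
  then show ?thesis
    unfolding boundary_topology_def by (simp add: topology_inverse')
qed

lemma topspace_boundary_topology [simp]: "topspace (boundary_topology M d z) = boundary M d z"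
proof -
  have "\<exists>r>0::real. boundary_nhd M d z v r \<subseteq> boundary M d z" for v
    by (rule exI[of _ 1]) (auto simp: boundary_nhd_def)
  then have "openin (boundary_topology M d z) (boundary M d z)"
    unfolding openin_boundary_topology by blast
  then show ?thesis
    by (metis openin_boundary_topology openin_subset openin_topspace subset_antisym)
qed


section \<open>The smashed product of pointed spaces\<close>

definition wedge :: "'a set \<Rightarrow> 'a \<Rightarrow> 'b set \<Rightarrow> 'b \<Rightarrow> ('a \<times> 'b) set" where
  "wedge U1 u1 U2 u2 = ({u1} \<times> U2) \<union> (U1 \<times> {u2})"

text \<open>The projection onto the set of classes that identifies the points of \<open>A\<close> and no others.\<close>

definition collapse :: "'a set \<Rightarrow> 'a \<Rightarrow> 'a set" where
  "collapse A p = (if p \<in> A then A else {p})"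

definition quotient_topology :: "'a topology \<Rightarrow> ('a \<Rightarrow> 'b) \<Rightarrow> 'b topology" where
  "quotient_topology X f = topology (\<lambda>W. W \<subseteq> f ` topspace X \<and>
     openin X {p \<in> topspace X. f p \<in> W})"

lemma openin_quotient_topology:
  "openin (quotient_topology X f) W \<longleftrightarrow> W \<subseteq> f ` topspace X \<and> openin X {p \<in> topspace X. f p \<in> W}"
proof -
  let ?P = "\<lambda>W. W \<subseteq> f ` topspace X \<and> openin X {p \<in> topspace X. f p \<in> W}"
  have "{p \<in> topspace X. f p \<in> S \<inter> T} = {p \<in> topspace X. f p \<in> S} \<inter> {p \<in> topspace X. f p \<in> T}"
    for S T by blast
  moreover have "{p \<in> topspace X. f p \<in> \<Union>K} = \<Union>((\<lambda>S. {p \<in> topspace X. f p \<in> S}) ` K)" for K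
    by blast
  ultimately have "istopology ?P"
    unfolding istopology_def by (auto intro!: openin_Int openin_Union simp del: Int_iff)
  then show ?thesis
    unfolding quotient_topology_def by (simp add: topology_inverse')
qed

lemma topspace_quotient_topology [simp]: "topspace (quotient_topology X f) = f ` topspace X"
proof -
  have "{p \<in> topspace X. f p \<in> f ` topspace X} = topspace X" by blast
  then have "openin (quotient_topology X f) (f ` topspace X)"
    by (simp add: openin_quotient_topology)
  then show ?thesis
    by (metis openin_quotient_topology openin_subset openin_topspace subset_antisym)
qed

lemma quotient_map_quotient_topology: "quotient_map X (quotient_topology X f) f"
  by (auto simp: quotient_map_def openin_quotient_topology)

definition smash_quotient :: "'a topology \<Rightarrow> 'a \<Rightarrow> 'b topology \<Rightarrow> 'b \<Rightarrow> ('a \<times> 'b) set topology" where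
  "smash_quotient T1 u1 T2 u2 =
     quotient_topology (prod_topology T1 T2) (collapse (wedge (topspace T1) u1 (topspace T2) u2))"

text \<open>
  The same quotient set. The quotient topology is kept except at the collapsed point, whose
  neighbourhoods must come from sets \<open>A \<times> U2 \<union> U1 \<times> B\<close> with \<open>A\<close>, \<open>B\<close> neighbourhoods of \<open>u1\<close>, \<open>u2\<close>.
  The two topologies agree if both factors are compact. In general they differ: for a circle and an
  infinite discrete space, \<open>smash_quotient\<close> is an infinite bouquet of circles with the CW topology,
  which is not first countable, whereas this one is metrizable. A boundary at infinity is always
  first countable, so for noncompact boundaries only this topology can be the right one.
\<close>

definition smash_product :: "'a topology \<Rightarrow> 'a \<Rightarrow> 'b topology \<Rightarrow> 'b \<Rightarrow> ('a \<times> 'b) set topology" where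
  "smash_product T1 u1 T2 u2 =
     (let U1 = topspace T1; U2 = topspace T2; V = wedge U1 u1 U2 u2 in
      topology (\<lambda>W. openin (smash_quotient T1 u1 T2 u2) W \<and>
        (V \<in> W \<longrightarrow> (\<exists>A B. openin T1 A \<and> u1 \<in> A \<and> openin T2 B \<and> u2 \<in> B \<and>
           collapse V ` (A \<times> U2 \<union> U1 \<times> B) \<subseteq> W))))"

lemma openin_smash_product:
  "openin (smash_product T1 u1 T2 u2) W \<longleftrightarrow> openin (smash_quotient T1 u1 T2 u2) W \<and>
     (wedge (topspace T1) u1 (topspace T2) u2 \<in> W \<longrightarrow>
       (\<exists>A B. openin T1 A \<and> u1 \<in> A \<and> openin T2 B \<and> u2 \<in> B \<and>
         collapse (wedge (topspace T1) u1 (topspace T2) u2) `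
           (A \<times> topspace T2 \<union> topspace T1 \<times> B) \<subseteq> W))"
proof -
  let ?V = "wedge (topspace T1) u1 (topspace T2) u2"
  let ?N = "\<lambda>A B. collapse ?V ` (A \<times> topspace T2 \<union> topspace T1 \<times> B)"
  let ?Q = "\<lambda>W. ?V \<in> W \<longrightarrow>
    (\<exists>A B. openin T1 A \<and> u1 \<in> A \<and> openin T2 B \<and> u2 \<in> B \<and> ?N A B \<subseteq> W)"
  have int: "?Q (S \<inter> T)" if S: "?Q S" and T: "?Q T" for S T
  proof
    assume V: "?V \<in> S \<inter> T"
    obtain A B where 1: "openin T1 A" "u1 \<in> A" "openin T2 B" "u2 \<in> B" "?N A B \<subseteq> S"
      using S V by blast
    obtain A' B' where 2: "openin T1 A'" "u1 \<in> A'" "openin T2 B'" "u2 \<in> B'" "?N A' B' \<subseteq> T"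
      using T V by blast
    have "?N (A \<inter> A') (B \<inter> B') \<subseteq> ?N A B \<inter> ?N A' B'" by blast
    then have "?N (A \<inter> A') (B \<inter> B') \<subseteq> S \<inter> T" using 1(5) 2(5) by blast
    with 1 2 show "\<exists>A B. openin T1 A \<and> u1 \<in> A \<and> openin T2 B \<and> u2 \<in> B \<and> ?N A B \<subseteq> S \<inter> T"
      by (intro exI[of _ "A \<inter> A'"] exI[of _ "B \<inter> B'"]) auto
  qed
  have un: "?Q (\<Union>K)" if K: "\<forall>S\<in>K. ?Q S" for K
  proof
    assume "?V \<in> \<Union>K"
    then obtain S where S: "S \<in> K" "?V \<in> S" by blast
    then obtain A B where "openin T1 A" "u1 \<in> A" "openin T2 B" "u2 \<in> B" "?N A B \<subseteq> S"
      using K by meson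
    then show "\<exists>A B. openin T1 A \<and> u1 \<in> A \<and> openin T2 B \<and> u2 \<in> B \<and> ?N A B \<subseteq> \<Union>K"
      using S(1) by (meson Sup_upper order_trans)
  qed
  let ?R = "\<lambda>W. openin (smash_quotient T1 u1 T2 u2) W \<and> ?Q W"
  have "?R (S \<inter> T)" if "?R S" "?R T" for S T
    by (rule conjI[OF openin_Int[OF conjunct1[OF that(1)] conjunct1[OF that(2)]]
          int[OF conjunct2[OF that(1)] conjunct2[OF that(2)]]])
  moreover have "?R (\<Union>K)" if K: "\<forall>S\<in>K. ?R S" for K
  proof (rule conjI)
    show "openin (smash_quotient T1 u1 T2 u2) (\<Union>K)"
      using K by (intro openin_Union) (rule conjunct1, rule bspec)
    show "?Q (\<Union>K)"
      by (rule un, rule ballI, rule conjunct2, rule bspec[OF K])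
  qed
  ultimately have "istopology ?R"
    unfolding istopology_def by (intro conjI[OF allI[OF allI[OF impI[OF impI]]] allI[OF impI]])
  then show ?thesis
    unfolding smash_product_def Let_def by (simp add: topology_inverse')
qed

lemma topspace_smash_product [simp]:
  assumes "u1 \<in> topspace T1" "u2 \<in> topspace T2"
  shows "topspace (smash_product T1 u1 T2 u2) =
    collapse (wedge (topspace T1) u1 (topspace T2) u2) ` (topspace T1 \<times> topspace T2)"
proof -
  let ?Q = "smash_quotient T1 u1 T2 u2"
  have top: "topspace ?Q =
      collapse (wedge (topspace T1) u1 (topspace T2) u2) ` (topspace T1 \<times> topspace T2)"
    by (simp add: smash_quotient_def)
  have "openin (smash_product T1 u1 T2 u2) (topspace ?Q)"
    unfolding openin_smash_product
  proof (intro conjI impI exI)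
    show "collapse (wedge (topspace T1) u1 (topspace T2) u2) `
        (topspace T1 \<times> topspace T2 \<union> topspace T1 \<times> topspace T2) \<subseteq> topspace ?Q"
      unfolding top by simp
  qed (simp_all only: assms openin_topspace)
  moreover have "openin ?Q (topspace (smash_product T1 u1 T2 u2))"
    using openin_topspace[of "smash_product T1 u1 T2 u2"] unfolding openin_smash_product
    by (rule conjunct1)
  ultimately have "topspace (smash_product T1 u1 T2 u2) = topspace ?Q"
    by (intro subset_antisym openin_subset)
  then show ?thesis by (simp add: top)
qed

lemma smash_product_eq_quotient:
  assumes c: "compact_space T1" "compact_space T2"
    and u: "u1 \<in> topspace T1" "u2 \<in> topspace T2"
  shows "smash_product T1 u1 T2 u2 = smash_quotient T1 u1 T2 u2"
proof -
  let ?V = "wedge (topspace T1) u1 (topspace T2) u2"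
  have "\<exists>A B. openin T1 A \<and> u1 \<in> A \<and> openin T2 B \<and> u2 \<in> B \<and>
      collapse ?V ` (A \<times> topspace T2 \<union> topspace T1 \<times> B) \<subseteq> W"
    if W: "openin (smash_quotient T1 u1 T2 u2) W" and V: "?V \<in> W" for W
  proof -
    define P where "P = {p \<in> topspace (prod_topology T1 T2). collapse ?V p \<in> W}"
    have P: "openin (prod_topology T1 T2) P"
      using W unfolding P_def smash_quotient_def openin_quotient_topology by (rule conjunct2)
    have "?V \<subseteq> topspace T1 \<times> topspace T2"
      using u unfolding wedge_def by blast
    then have VP: "?V \<subseteq> P"
      using V unfolding P_def by (auto simp: collapse_def)
    have 1: "compactin T1 {u1}" "compactin T1 (topspace T1)"
      "compactin T2 {u2}" "compactin T2 (topspace T2)"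
      using c u by (auto simp: compact_space_def)
    have s1: "{u1} \<times> topspace T2 \<subseteq> P" and s2: "topspace T1 \<times> {u2} \<subseteq> P"
      using VP unfolding wedge_def Un_subset_iff by simp_all
    obtain A A' where A: "openin T1 A" "{u1} \<subseteq> A" "topspace T2 \<subseteq> A'" "A \<times> A' \<subseteq> P"
      by (rule Wallace_theorem_prod_topology[OF 1(1) 1(4) P s1])
    obtain B' B where B: "openin T2 B" "{u2} \<subseteq> B" "topspace T1 \<subseteq> B'" "B' \<times> B \<subseteq> P"
      by (rule Wallace_theorem_prod_topology[OF 1(2) 1(3) P s2])
    have "A \<times> topspace T2 \<union> topspace T1 \<times> B \<subseteq> P"
      using A(3,4) B(3,4) by (meson Sigma_mono Un_least order_refl order_trans)
    then have "collapse ?V ` (A \<times> topspace T2 \<union> topspace T1 \<times> B) \<subseteq> W"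
      unfolding P_def by blast
    with A(1,2) B(1,2) show ?thesis
      by (intro exI[of _ A] exI[of _ B]) simp
  qed
  then have "openin (smash_product T1 u1 T2 u2) W \<longleftrightarrow> openin (smash_quotient T1 u1 T2 u2) W" for W
    unfolding openin_smash_product by (intro iffI conjI impI) (rule conjunct1)
  then show ?thesis
    unfolding topology_eq by (rule allI)
qed


section \<open>The product of two spaces along their Busemann functions\<close>

definition max_dist :: "('a \<Rightarrow> 'a \<Rightarrow> real) \<Rightarrow> ('b \<Rightarrow> 'b \<Rightarrow> real) \<Rightarrow> 'a \<times> 'b \<Rightarrow> 'a \<times> 'b \<Rightarrow> real" where
  "max_dist d1 d2 = (\<lambda>(x1, x2) (y1, y2). max (d1 x1 y1) (d2 x2 y2))"

definition busemann_product ::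
    "'a set \<Rightarrow> ('a \<Rightarrow> 'a \<Rightarrow> real) \<Rightarrow> (real \<Rightarrow> 'a) \<Rightarrow>
     'b set \<Rightarrow> ('b \<Rightarrow> 'b \<Rightarrow> real) \<Rightarrow> (real \<Rightarrow> 'b) \<Rightarrow> real \<Rightarrow> ('a \<times> 'b) set" where
  "busemann_product M1 d1 \<gamma>1 M2 d2 \<gamma>2 \<Delta> =
     {(x1, x2). x1 \<in> M1 \<and> x2 \<in> M2 \<and> \<bar>busemann d1 \<gamma>1 x1 - busemann d2 \<gamma>2 x2\<bar> \<le> \<Delta>}"

lemma Metric_space_busemann_product:
  assumes "Metric_space M1 d1" "Metric_space M2 d2"
  shows "Metric_space (busemann_product M1 d1 \<gamma>1 M2 d2 \<gamma>2 \<Delta>) (max_dist d1 d2)"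
proof -
  interpret M1: Metric_space M1 d1 by fact
  interpret M2: Metric_space M2 d2 by fact
  have "Metric_space (M1 \<times> M2) (max_dist d1 d2)"
  proof
    fix x y
    show "0 \<le> max_dist d1 d2 x y" by (auto simp: max_dist_def split: prod.splits intro: max.coboundedI1)
    show "max_dist d1 d2 x y = max_dist d1 d2 y x"
      by (auto simp: max_dist_def M1.commute M2.commute split: prod.splits)
  next
    fix x y assume "x \<in> M1 \<times> M2" "y \<in> M1 \<times> M2"
    then obtain x1 x2 y1 y2 where
      xy: "x = (x1, x2)" "y = (y1, y2)" "x1 \<in> M1" "y1 \<in> M1" "x2 \<in> M2" "y2 \<in> M2" by blast
    have "max (d1 x1 y1) (d2 x2 y2) = 0 \<longleftrightarrow> d1 x1 y1 = 0 \<and> d2 x2 y2 = 0"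
      using M1.nonneg[of x1 y1] M2.nonneg[of x2 y2] by linarith
    then show "max_dist d1 d2 x y = 0 \<longleftrightarrow> x = y"
      using xy by (simp add: max_dist_def)
  next
    fix x y z assume "x \<in> M1 \<times> M2" "y \<in> M1 \<times> M2" "z \<in> M1 \<times> M2"
    then obtain x1 x2 y1 y2 z1 z2 where
      "x = (x1, x2)" "y = (y1, y2)" "z = (z1, z2)" "x1 \<in> M1" "y1 \<in> M1" "z1 \<in> M1"
      "x2 \<in> M2" "y2 \<in> M2" "z2 \<in> M2" by blast
    then show "max_dist d1 d2 x z \<le> max_dist d1 d2 x y + max_dist d1 d2 y z"
      using M1.triangle[of x1 y1 z1] M2.triangle[of x2 y2 z2] by (auto simp: max_dist_def)
  qed
  then show ?thesis
    by (rule Metric_space.subspace) (auto simp: busemann_product_def)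
qed

end

theory Submission
  imports Defs
begin

text \<open>
  Everything is expressed by a Busemann function \<open>B\<close> and by \<open>H x y = (B x + B y - d x y) / 2\<close>.
  Letting the fourth point of the hyperbolicity inequality run along the ray turns it into
  \<open>H x y \<ge> min (H x w) (H w y) - C\<close>, and rough geodesics to points far out on the ray show that from
  every point one can descend towards the ray's limit at unit speed, up to \<open>C\<close>. Conversely these two
  properties imply hyperbolicity, and they imply rough geodesicity: descend from \<open>x\<close> to the level
  \<open>H x y\<close> and climb to \<open>y\<close>. On the product, \<open>H\<close> is within a bounded distance of the minimum of the
  two factors' \<open>H\<close>, so both properties are inherited.

  A sequence tends to infinity if either \<open>H (x i) z \<rightarrow> -\<infinity>\<close>, and all these sequences represent the
  limit of the ray, or \<open>H (x i) (x j) \<rightarrow> \<infinity>\<close>; sequences \<open>x\<close>, \<open>y\<close> of the second kind are equivalent iff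
  \<open>H (x i) (y j) \<rightarrow> \<infinity>\<close>. Near a boundary point of the second kind the topology is measured by
  \<open>H (x i) (y j)\<close>, near the limit of the ray by \<open>- H (y j) z\<close>. Since \<open>H\<close> of the product is a minimum,
  the second kind corresponds to pairs of points of the second kind, while being close to the
  limit of the ray only means that one of the two coordinates is.
\<close>

section \<open>Lower limits of Gromov products\<close>

lemma liminf_gromov_product_gtD:
  assumes "ereal r < liminf_gromov_product d z x y"
  shows "\<exists>N. \<forall>i\<ge>N. \<forall>j\<ge>N. r < gromov_product d z (x i) (y j)"
proof -
  have "\<forall>\<^sub>F p in sequentially \<times>\<^sub>F sequentially.
      ereal r < (case p of (i, j) \<Rightarrow> ereal (gromov_product d z (x i) (y j)))"
    using assms unfolding liminf_gromov_product_def by (rule less_LiminfD)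
  then show ?thesis
    unfolding eventually_prod_sequentially by auto
qed

lemma liminf_gromov_product_geI:
  assumes "\<And>i j. i \<ge> N \<Longrightarrow> j \<ge> N \<Longrightarrow> s \<le> gromov_product d z (x i) (y j)"
  shows "ereal s \<le> liminf_gromov_product d z x y"
  unfolding liminf_gromov_product_def
  by (rule Liminf_bounded) (use assms in \<open>auto simp: eventually_prod_sequentially\<close>)

lemma liminf_gromov_product_eq_infinity_iff:
  "liminf_gromov_product d z x y = \<infinity> \<longleftrightarrow>
    (\<forall>r. \<exists>N. \<forall>i\<ge>N. \<forall>j\<ge>N. r \<le> gromov_product d z (x i) (y j))" (is "?L \<longleftrightarrow> ?R")
proof
  assume ?L
  then have "ereal r < liminf_gromov_product d z x y" for r by simp
  then show ?R by (meson liminf_gromov_product_gtD less_imp_le)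
next
  assume R: ?R
  have "ereal r \<le> liminf_gromov_product d z x y" for r
    using R liminf_gromov_product_geI[of _ r d z x y] by meson
  then show ?L by (intro ereal_top) auto
qed


section \<open>Horospherical spaces\<close>

text \<open>
  The Gromov product of \<open>x\<close> and \<open>y\<close> based at the boundary point that \<open>B\<close> is a Busemann function of,
  with the opposite sign convention: up to a bounded error it is the value of \<open>B\<close> at the point of a
  rough geodesic from \<open>x\<close> to \<open>y\<close> which comes closest to that boundary point.
\<close>

definition horo_product :: "('a \<Rightarrow> 'a \<Rightarrow> real) \<Rightarrow> ('a \<Rightarrow> real) \<Rightarrow> 'a \<Rightarrow> 'a \<Rightarrow> real" where
  "horo_product d B x y = (B x + B y - d x y) / 2"

text \<open>These are the only properties of a Busemann function used below, with one constant
  \<open>C\<close> for all of them. No ray is mentioned, so that the product can be treated with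
  \<open>B1\<close> of the first coordinate instead of the Busemann function of a ray in the
  product.\<close>

locale horospherical = Metric_space M d for M :: "'a set" and d +
  fixes B :: "'a \<Rightarrow> real" and C :: real
  assumes C_nonneg: "0 \<le> C"
    and B_le: "x \<in> M \<Longrightarrow> y \<in> M \<Longrightarrow> B x \<le> B y + d x y"
    and horo_ultra: "x \<in> M \<Longrightarrow> y \<in> M \<Longrightarrow> w \<in> M \<Longrightarrow>
      min (horo_product d B x w) (horo_product d B w y) \<le> horo_product d B x y + C"
    and descend: "x \<in> M \<Longrightarrow> 0 \<le> t \<Longrightarrow> \<exists>p\<in>M. \<bar>d x p - t\<bar> \<le> C \<and> \<bar>B p - (B x - t)\<bar> \<le> C"
begin

abbreviation H :: "'a \<Rightarrow> 'a \<Rightarrow> real" where "H \<equiv> horo_product d B"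

lemma dist_eq: "d x y = B x + B y - 2 * H x y"
  by (simp add: horo_product_def field_simps)

lemma H_commute: "H x y = H y x"
  by (simp add: horo_product_def commute)

lemma H_le: "x \<in> M \<Longrightarrow> y \<in> M \<Longrightarrow> H x y \<le> B x" "x \<in> M \<Longrightarrow> y \<in> M \<Longrightarrow> H x y \<le> B y"
  using B_le[of x y] B_le[of y x] commute[of x y] by (auto simp: horo_product_def)

text \<open>The ultrametric inequality bounds \<open>H x y\<close> from below through
  \<open>v\<close> and through \<open>w\<close>, and \<open>H v w\<close> through \<open>x\<close>
  and through \<open>y\<close>, each at cost \<open>C\<close>. What remains is a case distinction on
  which terms attain the minima.\<close>

lemma H_four_point:
  assumes "x \<in> M" "y \<in> M" "v \<in> M" "w \<in> M"
  shows "min (H x v + H y w) (H x w + H y v) \<le> H x y + H v w + 2 * C"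
  using assms horo_ultra[of x y v] horo_ultra[of x y w] horo_ultra[of v w x] horo_ultra[of v w y]
  by (simp add: H_commute min_le_iff_disj) argo

text \<open>All three pairings of the four points contain the same sum of \<open>B\<close> values,
  which cancels. The rest is \<open>H_four_point\<close> with the sign reversed and a factor
  2.\<close>

lemma gromov_hyperbolic: "gromov_hyperbolic M d"
  unfolding gromov_hyperbolic_def
proof (intro exI[of _ "2 * C"] conjI ballI)
  fix x y v w assume "x \<in> M" "y \<in> M" "v \<in> M" "w \<in> M"
  from H_four_point[OF this] show "d x y + d v w \<le> max (d x v + d y w) (d x w + d y v) + 2 * (2 * C)"
    by (simp add: dist_eq min_le_iff_disj le_max_iff_disj) argo
qed (use C_nonneg in simp)

lemma roughly_geodesic: "roughly_geodesic M d"
proof -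
  \<comment> \<open>For \<open>t = 0\<close>, \<open>descend\<close> only yields a point near
    \<open>x\<close>. Choosing \<open>x\<close> itself there lets the rough geodesic hit its end
    points exactly.\<close>
  have "\<forall>x t. \<exists>p. x \<in> M \<and> 0 \<le> t \<longrightarrow> (p \<in> M \<and> \<bar>d x p - t\<bar> \<le> C \<and> \<bar>B p - (B x - t)\<bar> \<le> C) \<and>
      (t = 0 \<longrightarrow> p = x)"
  proof (intro allI)
    fix x t
    show "\<exists>p. x \<in> M \<and> 0 \<le> t \<longrightarrow> (p \<in> M \<and> \<bar>d x p - t\<bar> \<le> C \<and> \<bar>B p - (B x - t)\<bar> \<le> C) \<and>
      (t = 0 \<longrightarrow> p = x)"
    proof (cases "t = 0")
      case True
      then show ?thesis using C_nonneg by (intro exI[of _ x]) auto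
    next
      case False
      then show ?thesis using descend[of x t] by auto
    qed
  qed
  then obtain p where p': "\<And>x t. x \<in> M \<and> 0 \<le> t \<longrightarrow>
      (p x t \<in> M \<and> \<bar>d x (p x t) - t\<bar> \<le> C \<and> \<bar>B (p x t) - (B x - t)\<bar> \<le> C) \<and> (t = 0 \<longrightarrow> p x t = x)"
    by metis
  have p: "p x t \<in> M" "\<bar>d x (p x t) - t\<bar> \<le> C" "\<bar>B (p x t) - (B x - t)\<bar> \<le> C"
    if "x \<in> M" "0 \<le> t" for x t using p' that by auto
  have p0: "p x 0 = x" if "x \<in> M" for x using p' that by auto
  have pH: "H x (p x t) \<ge> B x - t - C" if "x \<in> M" "0 \<le> t" for x t
    using p[OF that] by (simp add: horo_product_def abs_le_iff field_simps)
  \<comment> \<open>Two points on one descending curve: the ultrametric inequality through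
    \<open>x\<close> bounds the distance from above, the triangle inequality from below.\<close>
  have same: "\<bar>d (p x s) (p x t) - \<bar>s - t\<bar>\<bar> \<le> 6 * C" if x: "x \<in> M" and st: "0 \<le> s" "0 \<le> t" for x s t
  proof -
    have "min (H (p x s) x) (H x (p x t)) \<le> H (p x s) (p x t) + C"
      using p x st by (intro horo_ultra) auto
    with pH[OF x st(1)] pH[OF x st(2)] have "B x - max s t - 2 * C \<le> H (p x s) (p x t)"
      using H_commute[of x "p x s"] by linarith
    moreover have "2 * max s t = s + t + \<bar>s - t\<bar>" by linarith
    ultimately have "d (p x s) (p x t) \<le> \<bar>s - t\<bar> + 6 * C"
      using p(3)[OF x st(1)] p(3)[OF x st(2)] dist_eq[of "p x s" "p x t"] by linarith
    moreover have "\<bar>s - t\<bar> \<le> d (p x s) (p x t) + 6 * C"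
      using triangle[of x "p x s" "p x t"] triangle[of x "p x t" "p x s"] x p[OF x st(1)]
        p[OF x st(2)] commute[of "p x s" "p x t"] by linarith
    ultimately show ?thesis by linarith
  qed
  \<comment> \<open>The bounds on \<open>s\<close> and \<open>t\<close> keep both points at or above
    the level \<open>H x y\<close>, up to \<open>C\<close>. Chaining the ultrametric inequality
    through \<open>y\<close> and then \<open>x\<close> therefore loses little more than
    \<open>H x y\<close>.\<close>
  have cross: "\<bar>d (p x s) (p y t) - (d x y - s - t)\<bar> \<le> 8 * C"
    if xy: "x \<in> M" "y \<in> M" and s: "0 \<le> s" "s \<le> B x - H x y" and t: "0 \<le> t" "t \<le> B y - H x y" for x y s t
  proof -
    note ps = p[OF xy(1) s(1)] and pt = p[OF xy(2) t(1)]
    have "min (H (p x s) x) (H x (p y t)) \<le> H (p x s) (p y t) + C"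
      using ps pt xy by (intro horo_ultra) auto
    moreover have "min (H x y) (H y (p y t)) \<le> H x (p y t) + C"
      using ps pt xy by (intro horo_ultra) auto
    ultimately have "H x y - 3 * C \<le> H (p x s) (p y t)"
      using pH[OF xy(1) s(1)] pH[OF xy(2) t(1)] s(2) t(2) C_nonneg H_commute[of x "p x s"] by linarith
    then have "d (p x s) (p y t) \<le> d x y - s - t + 8 * C"
      using ps(3) pt(3) dist_eq[of x y] dist_eq[of "p x s" "p y t"] by linarith
    moreover have "d x y - s - t \<le> d (p x s) (p y t) + 8 * C"
      using triangle[of x "p x s" y] triangle[of "p x s" "p y t" y] xy ps pt commute[of y "p y t"]
        C_nonneg by linarith
    ultimately show ?thesis by linarith
  qed
  show ?thesis
    unfolding roughly_geodesic_def
  proof (rule exI[of _ "8 * C"], intro conjI ballI)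
    fix x y assume xy: "x \<in> M" "y \<in> M"
    define L where "L = d x y"
    define a where "a = B x - H x y"
    have L: "L - a = B y - H x y" "0 \<le> a" "a \<le> L"
      using H_le[OF xy] by (auto simp: L_def a_def horo_product_def field_simps)
    \<comment> \<open>Time \<open>a\<close> is where the descent from \<open>x\<close> reaches the
      level \<open>H x y\<close>. The test \<open>t = 0\<close> makes the curve start at
      \<open>x\<close> even if \<open>a = 0\<close>.\<close>
    define \<sigma> where "\<sigma> t = (if t = 0 \<or> t < a then p x t else p y (L - t))" for t
    have rough: "\<bar>d (\<sigma> s) (\<sigma> t) - \<bar>s - t\<bar>\<bar> \<le> 8 * C" if st: "s \<in> {0..L}" "t \<in> {0..L}" "s \<le> t" for s t
    proof -
      consider "s = 0 \<or> s < a" "t = 0 \<or> t < a" | "s = 0 \<or> s < a" "\<not> (t = 0 \<or> t < a)"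
        | "\<not> (s = 0 \<or> s < a)" "\<not> (t = 0 \<or> t < a)" using st by force
      then show ?thesis
      proof cases
        case 1
        then show ?thesis using same[of x s t] st xy C_nonneg unfolding \<sigma>_def by auto
      next
        case 2
        then have "\<bar>d (p x s) (p y (L - t)) - (L - s - (L - t))\<bar> \<le> 8 * C"
          unfolding L_def using L st by (intro cross[OF xy]) (auto simp: a_def L_def)
        then show ?thesis using 2 st(3) unfolding \<sigma>_def by simp
      next
        case 3
        then show ?thesis using same[of y "L - s" "L - t"] st xy C_nonneg unfolding \<sigma>_def by auto
      qed
    qed
    have "rough_isometric_on M d (8 * C) {0..L} \<sigma>"
      unfolding rough_isometric_on_def
    proof (intro conjI ballI)
      show "\<sigma> ` {0..L} \<subseteq> M"
        using p(1) xy by (auto simp: \<sigma>_def)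
      fix s t assume st: "s \<in> {0..L}" "t \<in> {0..L}"
      have "\<bar>d (\<sigma> s) (\<sigma> t) - \<bar>s - t\<bar>\<bar> \<le> 8 * C"
        using rough[OF st] rough[OF st(2,1)] commute[of "\<sigma> s" "\<sigma> t"] by (cases "s \<le> t") auto
      then show "\<bar>s - t\<bar> - 8 * C \<le> d (\<sigma> s) (\<sigma> t)" "d (\<sigma> s) (\<sigma> t) \<le> \<bar>s - t\<bar> + 8 * C" by linarith+
    qed
    moreover have "\<sigma> 0 = x" using p0 xy by (simp add: \<sigma>_def)
    moreover have "\<sigma> L = y"
    proof (cases "L = 0")
      case True
      then show ?thesis using \<open>\<sigma> 0 = x\<close> xy by (simp add: L_def)
    next
      case False
      then show ?thesis using L p0 xy by (simp add: \<sigma>_def)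
    qed
    ultimately show "\<exists>\<alpha> \<omega> \<gamma>. \<alpha> \<le> \<omega> \<and> rough_isometric_on M d (8 * C) {\<alpha>..\<omega>} \<gamma> \<and> \<gamma> \<alpha> = x \<and> \<gamma> \<omega> = y"
      using L by (intro exI[of _ 0] exI[of _ L] exI[of _ \<sigma>]) auto
  qed (use C_nonneg in simp)
qed

lemma descend_to:
  assumes "x \<in> M" "l \<le> B x"
  obtains p where "p \<in> M" "\<bar>B p - l\<bar> \<le> C" "l - C \<le> H x p"
proof -
  obtain p where p: "p \<in> M" "\<bar>d x p - (B x - l)\<bar> \<le> C" "\<bar>B p - l\<bar> \<le> C"
    using descend[of x "B x - l"] assms by auto
  then have "l - C \<le> H x p"
    using dist_eq[of x p] by linarith
  with p show thesis by (intro that)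
qed

text \<open>Twice the difference is \<open>B v - B w\<close> plus \<open>d x w - d x v\<close>, and
  each of these is at most \<open>d v w\<close> in absolute value.\<close>

lemma H_base_change:
  assumes "x \<in> M" "v \<in> M" "w \<in> M"
  shows "\<bar>H x v - H x w\<bar> \<le> d v w"
  using triangle[of x v w] triangle[of x w v] B_le[of v w] B_le[of w v] dist_eq[of x v] dist_eq[of x w]
    commute[of v w] assms by linarith

lemma H_self: "x \<in> M \<Longrightarrow> H x x = B x"
  by (simp add: horo_product_def)

end


section \<open>The boundary of a horospherical space\<close>

locale based_horospherical = horospherical +
  fixes z assumes z: "z \<in> M"
begin

abbreviation converges :: "(nat \<Rightarrow> 'a) \<Rightarrow> bool" where
  "converges \<equiv> converges_to_infinity M d z"

abbreviation cls :: "(nat \<Rightarrow> 'a) \<Rightarrow> (nat \<Rightarrow> 'a) set" where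
  "cls \<equiv> boundary_class M d z"

abbreviation gp :: "'a \<Rightarrow> 'a \<Rightarrow> real" where
  "gp \<equiv> gromov_product d z"

section \<open>Gromov products at the base point in terms of \<open>H\<close>\<close>

lemma gp_eq: "gp x y = B z + H x y - H x z - H y z"
  by (simp add: gromov_product_def horo_product_def field_simps)

lemma gp_commute: "gp x y = gp y x"
  by (simp add: gp_eq H_commute)

text \<open>This is the four point condition with the base point \<open>z\<close> as fourth
  point.\<close>

lemma gp_hyperbolic:
  assumes "x \<in> M" "y \<in> M" "w \<in> M"
  shows "min (gp x w) (gp w y) \<le> gp x y + 2 * C"
  using H_four_point[OF assms(1,2,3) z] by (simp add: gp_eq H_commute min_le_iff_disj) argo

lemma gp_le:
  assumes "x \<in> M" "y \<in> M" "K \<le> H x z" "K \<le> H y z"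
  shows "gp x y \<le> H x y + B z - 2 * K"
  using assms(3,4) by (simp add: gp_eq)

lemma gp_ge: "x \<in> M \<Longrightarrow> y \<in> M \<Longrightarrow> H x y - B z \<le> gp x y"
  using H_le(2)[of x z] H_le(2)[of y z] z by (simp add: gp_eq)

text \<open>The ultrametric inequality through \<open>z\<close> bounds \<open>H x y\<close> below by
  the smaller of \<open>H x z\<close> and \<open>H y z\<close>; subtracting both leaves the
  larger.\<close>

lemma gp_ge_max: "x \<in> M \<Longrightarrow> y \<in> M \<Longrightarrow> B z - C - max (H x z) (H y z) \<le> gp x y"
  using horo_ultra[of x y z] z by (simp add: gp_eq H_commute)

text \<open>Since \<open>H y z\<close> exceeds \<open>H x z + C\<close>, the minimum in the
  ultrametric inequality through \<open>y\<close> must be \<open>H x y\<close>, so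
  \<open>H x y\<close> is at most \<open>H x z + C\<close>.\<close>

lemma gp_le_of_separated:
  assumes "x \<in> M" "y \<in> M" "H x z < H y z - C"
  shows "gp x y \<le> B z + C - H y z"
  using horo_ultra[of x z y] assms z by (simp add: gp_eq)

lemma H_base_ge_of_gp:
  assumes "x \<in> M" "y \<in> M" "K \<le> H y z" "B z + C - K < gp x y"
  shows "K - C \<le> H x z"
  using gp_le_of_separated[OF assms(1,2)] assms(3,4) by linarith

section \<open>The two kinds of sequences converging to infinity\<close>

definition low :: "(nat \<Rightarrow> 'a) \<Rightarrow> bool" where
  "low x \<longleftrightarrow> range x \<subseteq> M \<and> (\<forall>K. \<exists>N. \<forall>i\<ge>N. H (x i) z \<le> K)"

definition high :: "(nat \<Rightarrow> 'a) \<Rightarrow> bool" where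
  "high x \<longleftrightarrow> range x \<subseteq> M \<and> (\<forall>R. \<exists>N. \<forall>i\<ge>N. \<forall>j\<ge>N. R \<le> H (x i) (x j))"

text \<open>The boundary point that \<open>B\<close> is a Busemann function of.\<close>

definition apex :: "(nat \<Rightarrow> 'a) set" where
  "apex = {x. low x}"

text \<open>Every late term is compared with the base point through one fixed late term
  \<open>x N\<close>.\<close>

lemma high_bounded:
  assumes "high x"
  obtains K N where "\<And>i. i \<ge> N \<Longrightarrow> K \<le> H (x i) z"
proof -
  have x: "x i \<in> M" for i using assms by (auto simp: high_def)
  obtain N where N: "\<And>i j. i \<ge> N \<Longrightarrow> j \<ge> N \<Longrightarrow> 0 \<le> H (x i) (x j)"
    using assms unfolding high_def by meson
  have "min 0 (H (x N) z) - C \<le> H (x i) z" if "i \<ge> N" for i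
    using horo_ultra[of "x i" z "x N"] N[OF that order_refl] x z by force
  then show ?thesis using that by blast
qed

text \<open>As \<open>y\<close> is not low, there is a late \<open>y j\<close> whose
  \<open>H\<close> with \<open>z\<close> exceeds a fixed \<open>K\<close>. A large Gromov product
  with this single point keeps all late \<open>x i\<close> from being low.\<close>

lemma bounded_of_gp:
  assumes "range x \<subseteq> M" "range y \<subseteq> M" and y: "\<not> low y"
    and gp: "\<And>R. \<exists>N. \<forall>i\<ge>N. \<forall>j\<ge>N. R \<le> gp (x i) (y j)"
  shows "\<exists>K N. \<forall>i\<ge>N. K \<le> H (x i) z"
proof -
  obtain K where K: "\<And>N. \<exists>j\<ge>N. K < H (y j) z"
    using assms unfolding low_def by (meson not_le)
  obtain N where N: "\<And>i j. i \<ge> N \<Longrightarrow> j \<ge> N \<Longrightarrow> B z + C - K + 1 \<le> gp (x i) (y j)"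
    using gp by meson
  obtain j where j: "j \<ge> N" "K < H (y j) z" using K by blast
  have "K - C \<le> H (x i) z" if "i \<ge> N" for i
    using N[OF that j(1)] j(2) assms(1,2) by (intro H_base_ge_of_gp[of _ "y j"]) auto
  then show ?thesis by blast
qed

lemma converges_iff: "converges x \<longleftrightarrow> range x \<subseteq> M \<and> (\<forall>R. \<exists>N. \<forall>i\<ge>N. \<forall>j\<ge>N. R \<le> gp (x i) (x j))"
  by (simp add: converges_to_infinity_def liminf_gromov_product_eq_infinity_iff)

lemma converges_in: "converges x \<Longrightarrow> x i \<in> M"
  by (auto simp: converges_iff)

lemma not_low_and_high: "low x \<Longrightarrow> high x \<Longrightarrow> False"
proof -
  assume "low x" "high x"
  from \<open>high x\<close> obtain K N where KN: "\<And>i. i \<ge> N \<Longrightarrow> K \<le> H (x i) z" by (rule high_bounded) blast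
  from \<open>low x\<close> obtain N' where "\<And>i. i \<ge> N' \<Longrightarrow> H (x i) z \<le> K - 1"
    unfolding low_def by meson
  from this[of "max N N'"] show False using KN[of "max N N'"] by simp
qed

lemma boundary_rel_iff: "(x, y) \<in> boundary_rel M d z \<longleftrightarrow>
    converges x \<and> converges y \<and> (\<forall>R. \<exists>N. \<forall>i\<ge>N. \<forall>j\<ge>N. R \<le> gp (x i) (y j))"
  by (simp add: boundary_rel_def liminf_gromov_product_eq_infinity_iff)

lemma low_rel:
  assumes "low x" "low y"
  shows "\<exists>N. \<forall>i\<ge>N. \<forall>j\<ge>N. R \<le> gp (x i) (y j)"
proof -
  obtain N where N: "\<And>i. i \<ge> N \<Longrightarrow> H (x i) z \<le> B z - C - R"
    using assms(1) unfolding low_def by meson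
  obtain N' where N': "\<And>i. i \<ge> N' \<Longrightarrow> H (y i) z \<le> B z - C - R"
    using assms(2) unfolding low_def by meson
  have "R \<le> gp (x i) (y j)" if "i \<ge> max N N'" "j \<ge> max N N'" for i j
    using gp_ge_max[of "x i" "y j"] N[of i] N'[of j] that assms unfolding low_def by force
  then show ?thesis by blast
qed

text \<open>For high sequences \<open>H (x i) z\<close> lies between a constant and
  \<open>B z\<close>, so \<open>gp\<close> and \<open>H\<close> differ by a bounded amount.\<close>

lemma high_rel_iff:
  assumes "high x" "high y"
  shows "(\<forall>R. \<exists>N. \<forall>i\<ge>N. \<forall>j\<ge>N. R \<le> gp (x i) (y j)) \<longleftrightarrow>
    (\<forall>R. \<exists>N. \<forall>i\<ge>N. \<forall>j\<ge>N. R \<le> H (x i) (y j))" (is "?L \<longleftrightarrow> ?R")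
proof -
  have m: "x i \<in> M" "y i \<in> M" for i using assms by (auto simp: high_def)
  obtain K1 N1 where 1: "\<And>i. i \<ge> N1 \<Longrightarrow> K1 \<le> H (x i) z" using assms(1) by (rule high_bounded) blast
  obtain K2 N2 where 2: "\<And>i. i \<ge> N2 \<Longrightarrow> K2 \<le> H (y i) z" using assms(2) by (rule high_bounded) blast
  show ?thesis
  proof
    assume L: ?L
    show ?R
    proof
      fix R
      obtain N where N: "\<And>i j. i \<ge> N \<Longrightarrow> j \<ge> N \<Longrightarrow> R + B z - 2 * min K1 K2 \<le> gp (x i) (y j)"
        using L by meson
      have "R \<le> H (x i) (y j)" if "i \<ge> max N (max N1 N2)" "j \<ge> max N (max N1 N2)" for i j
        using N[of i j] gp_le[of "x i" "y j" "min K1 K2"] 1[of i] 2[of j] m that by force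
      then show "\<exists>N. \<forall>i\<ge>N. \<forall>j\<ge>N. R \<le> H (x i) (y j)" by blast
    qed
  next
    assume R: ?R
    show ?L
    proof
      fix R
      obtain N where N: "\<And>i j. i \<ge> N \<Longrightarrow> j \<ge> N \<Longrightarrow> R + B z \<le> H (x i) (y j)"
        using R by meson
      have "R \<le> gp (x i) (y j)" if "i \<ge> N" "j \<ge> N" for i j
        using N[OF that] gp_ge[OF m, of i j] by linarith
      then show "\<exists>N. \<forall>i\<ge>N. \<forall>j\<ge>N. R \<le> gp (x i) (y j)" by blast
    qed
  qed
qed

text \<open>A convergent sequence that is not low has \<open>H (x i) z\<close> bounded below, by
  \<open>bounded_of_gp\<close> applied to the sequence and itself; then large \<open>gp\<close>
  means large \<open>H\<close>.\<close>

lemma converges_iff_low_or_high: "converges x \<longleftrightarrow> low x \<or> high x"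
proof
  assume x: "converges x"
  have "high x" if nl: "\<not> low x"
  proof -
    from x have m: "range x \<subseteq> M" and gp: "\<And>R. \<exists>N. \<forall>i\<ge>N. \<forall>j\<ge>N. R \<le> gp (x i) (x j)"
      by (auto simp: converges_iff)
    obtain K N where K: "\<And>i. i \<ge> N \<Longrightarrow> K \<le> H (x i) z" using bounded_of_gp[OF m m nl gp] by blast
    have "\<exists>N. \<forall>i\<ge>N. \<forall>j\<ge>N. R \<le> H (x i) (x j)" for R
    proof -
      obtain N' where N': "\<And>i j. i \<ge> N' \<Longrightarrow> j \<ge> N' \<Longrightarrow> R + B z - 2 * K \<le> gp (x i) (x j)"
        using gp by meson
      have "R \<le> H (x i) (x j)" if "i \<ge> max N N'" "j \<ge> max N N'" for i j
        using N'[of i j] gp_le[of "x i" "x j" K] K[of i] K[of j] m that by force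
      then show ?thesis by blast
    qed
    then show "high x" using m by (auto simp: high_def)
  qed
  then show "low x \<or> high x" by blast
next
  assume "low x \<or> high x"
  then show "converges x"
  proof
    assume "low x" then show ?thesis using low_rel by (auto simp: converges_iff low_def)
  next
    assume "high x" then show ?thesis
      using high_rel_iff[of x x] by (auto simp: converges_iff high_def)
  qed
qed

section \<open>Boundary classes and the apex\<close>

lemma equiv_boundary_rel: "equiv {x. converges x} (boundary_rel M d z)"
proof (rule equivI)
  show "boundary_rel M d z \<subseteq> {x. converges x} \<times> {x. converges x}"
    by (auto simp: boundary_rel_def)
  show "refl_on {x. converges x} (boundary_rel M d z)"
    by (rule refl_onI) (auto simp: boundary_rel_def converges_to_infinity_def)
  show "sym (boundary_rel M d z)"
    by (rule symI) (auto simp: boundary_rel_iff gp_commute; metis gp_commute)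
  show "trans (boundary_rel M d z)"
  proof (rule transI)
    fix x y w assume xy: "(x, y) \<in> boundary_rel M d z" and yw: "(y, w) \<in> boundary_rel M d z"
    have m: "x i \<in> M" "y i \<in> M" "w i \<in> M" for i
      using xy yw by (auto simp: boundary_rel_iff converges_in)
    have "\<exists>N. \<forall>i\<ge>N. \<forall>j\<ge>N. R \<le> gp (x i) (w j)" for R
    proof -
      obtain N where N: "\<And>i j. i \<ge> N \<Longrightarrow> j \<ge> N \<Longrightarrow> R + 2 * C \<le> gp (x i) (y j)"
        using xy unfolding boundary_rel_iff by meson
      obtain N' where N': "\<And>i j. i \<ge> N' \<Longrightarrow> j \<ge> N' \<Longrightarrow> R + 2 * C \<le> gp (y i) (w j)"
        using yw unfolding boundary_rel_iff by meson
      have "R \<le> gp (x i) (w j)" if "i \<ge> max N N'" "j \<ge> max N N'" for i j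
        using N[of i i] N'[of i j] gp_hyperbolic[of "x i" "w j" "y i"] m that by force
      then show ?thesis by blast
    qed
    then show "(x, w) \<in> boundary_rel M d z" using xy yw by (simp add: boundary_rel_iff)
  qed
qed

lemma cls_in_boundary: "converges x \<Longrightarrow> cls x \<in> boundary M d z"
  unfolding boundary_def boundary_class_def by (simp add: quotientI)

lemma boundary_cases:
  assumes "v \<in> boundary M d z"
  obtains x where "converges x" "v = cls x"
  using assms unfolding boundary_def boundary_class_def by (auto elim: quotientE)

lemma cls_eq_iff:
  assumes "converges x" "converges y"
  shows "cls x = cls y \<longleftrightarrow> (\<forall>R. \<exists>N. \<forall>i\<ge>N. \<forall>j\<ge>N. R \<le> gp (x i) (y j))"
  using eq_equiv_class_iff[OF equiv_boundary_rel, of x y] assms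
  by (simp add: boundary_class_def boundary_rel_iff)

lemma cls_eq_iff_high:
  assumes "high x" "high y"
  shows "cls x = cls y \<longleftrightarrow> (\<forall>R. \<exists>N. \<forall>i\<ge>N. \<forall>j\<ge>N. R \<le> H (x i) (y j))"
  using assms by (simp add: cls_eq_iff high_rel_iff converges_iff_low_or_high)

text \<open>Equivalence with a sequence that is not low would keep \<open>H (x i) z\<close> bounded
  below.\<close>

lemma cls_ne_of_low_high:
  assumes "low x" "high y" "cls x = cls y"
  shows False
proof -
  have gp: "\<exists>N. \<forall>i\<ge>N. \<forall>j\<ge>N. R \<le> gp (x i) (y j)" for R
    using assms cls_eq_iff[of x y] by (simp add: converges_iff_low_or_high)
  have m: "range x \<subseteq> M" "range y \<subseteq> M" using assms(1,2) by (auto simp: low_def high_def)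
  have "\<not> low y" using assms(2) not_low_and_high by blast
  then obtain K N where K: "\<And>i. i \<ge> N \<Longrightarrow> K \<le> H (x i) z"
    using bounded_of_gp[OF m _ gp] by blast
  obtain N' where N': "\<And>i. i \<ge> N' \<Longrightarrow> H (x i) z \<le> K - 1" using assms(1) unfolding low_def by meson
  show False using K[of "max N N'"] N'[of "max N N'"] by simp
qed

text \<open>Any two low sequences are equivalent by \<open>low_rel\<close>, and no high sequence
  joins them, so the class is the set of all low sequences.\<close>

lemma cls_low: assumes "low x" shows "cls x = apex"
proof -
  have "(x, y) \<in> boundary_rel M d z \<longleftrightarrow> low y" for y
  proof
    assume xy: "(x, y) \<in> boundary_rel M d z"
    then have "cls x = cls y" "low y \<or> high y"
      using cls_eq_iff[of x y] by (auto simp: boundary_rel_iff converges_iff_low_or_high)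
    then show "low y" using assms cls_ne_of_low_high by blast
  next
    assume "low y" then show "(x, y) \<in> boundary_rel M d z"
      using assms low_rel by (auto simp: boundary_rel_iff converges_iff_low_or_high)
  qed
  then show ?thesis by (auto simp: boundary_class_def apex_def)
qed

lemma exists_low: "\<exists>x. low x"
proof -
  have "\<exists>p\<in>M. \<bar>B p - (B z - real i)\<bar> \<le> C" for i using descend[OF z, of "real i"] by auto
  then obtain p where p: "\<And>i. p i \<in> M" "\<And>i. \<bar>B (p i) - (B z - real i)\<bar> \<le> C" by metis
  have "H (p i) z \<le> K" if "i \<ge> nat \<lceil>B z + C - K\<rceil>" for i K
    using H_le(1)[OF p(1)[of i] z] p(2)[of i] that by linarith
  then have "low p" using p(1) unfolding low_def by blast
  then show ?thesis by blast
qed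

lemma apex_in_boundary: "apex \<in> boundary M d z"
  using exists_low cls_low cls_in_boundary converges_iff_low_or_high by metis

lemma cls_eq_apex_iff: "converges x \<Longrightarrow> cls x = apex \<longleftrightarrow> low x"
  using cls_low exists_low cls_ne_of_low_high converges_iff_low_or_high by metis

lemma cls_high: "high x \<Longrightarrow> cls x \<noteq> apex"
  using cls_eq_apex_iff converges_iff_low_or_high not_low_and_high by blast

lemma high_iff: "high x \<longleftrightarrow> converges x \<and> cls x \<noteq> apex"
  using cls_high cls_low converges_iff_low_or_high by blast

lemma high_cases:
  assumes "v \<in> boundary M d z" "v \<noteq> apex"
  obtains x where "high x" "v = cls x"
  using assms boundary_cases high_iff by metis

section \<open>Basic neighbourhoods measured by \<open>H\<close>\<close>

abbreviation nhd :: "(nat \<Rightarrow> 'a) set \<Rightarrow> real \<Rightarrow> (nat \<Rightarrow> 'a) set set" where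
  "nhd \<equiv> boundary_nhd M d z"

text \<open>A neighbourhood only promises some pair of representatives. Passing to given ones costs
  \<open>2 * C\<close> on each side.\<close>

lemma gp_ge_of_nhd:
  assumes x: "converges x" and y: "converges y" and nhd: "cls y \<in> nhd (cls x) r"
  shows "\<exists>N. \<forall>i\<ge>N. \<forall>j\<ge>N. r - 4 * C \<le> gp (x i) (y j)"
proof -
  obtain x' y' where x': "converges x'" "cls x' = cls x" and y': "converges y'" "cls y' = cls y"
    and lim: "ereal r < liminf_gromov_product d z x' y'"
    using nhd unfolding boundary_nhd_def represents_def by blast
  have m: "x i \<in> M" "y i \<in> M" "x' i \<in> M" "y' i \<in> M" for i
    using x y x'(1) y'(1) by (auto intro: converges_in)
  obtain N where N: "\<And>i j. i \<ge> N \<Longrightarrow> j \<ge> N \<Longrightarrow> r < gp (x' i) (y' j)"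
    using liminf_gromov_product_gtD[OF lim] by blast
  obtain Nx where Nx: "\<And>i j. i \<ge> Nx \<Longrightarrow> j \<ge> Nx \<Longrightarrow> r \<le> gp (x i) (x' j)"
    using cls_eq_iff[OF x x'(1)] x'(2) by metis
  obtain Ny where Ny: "\<And>i j. i \<ge> Ny \<Longrightarrow> j \<ge> Ny \<Longrightarrow> r \<le> gp (y' i) (y j)"
    using cls_eq_iff[OF y'(1) y] y'(2) by metis
  have "r - 4 * C \<le> gp (x i) (y j)" if i: "i \<ge> Max {N, Nx, Ny}" and j: "j \<ge> Max {N, Nx, Ny}" for i j
  proof -
    have "r - 2 * C \<le> gp (x i) (y' j)"
      using gp_hyperbolic[OF m(1) m(4) m(3), of i i j] N[of i j] Nx[of i i] i j by simp
    then show ?thesis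
      using gp_hyperbolic[OF m(1) m(2) m(4), of i j j] Ny[of j j] C_nonneg i j by simp
  qed
  then show ?thesis by blast
qed

lemma nhd_of_gp_ge:
  assumes "converges x" "converges y" "r < s"
    and "\<And>i j. i \<ge> N \<Longrightarrow> j \<ge> N \<Longrightarrow> s \<le> gp (x i) (y j)"
  shows "cls y \<in> nhd (cls x) r"
proof -
  have "ereal s \<le> liminf_gromov_product d z x y"
    using assms(4) by (rule liminf_gromov_product_geI)
  then have "ereal r < liminf_gromov_product d z x y"
    by (rule less_le_trans[rotated]) (use assms(3) in simp)
  then show ?thesis
    using assms(1,2) cls_in_boundary unfolding boundary_nhd_def represents_def by blast
qed

lemma nhd_refl:
  assumes "v \<in> boundary M d z"
  shows "v \<in> nhd v r"
proof -
  from assms obtain x where x: "converges x" "v = cls x" by (rule boundary_cases)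
  then obtain N where "\<And>i j. i \<ge> N \<Longrightarrow> j \<ge> N \<Longrightarrow> r + 1 \<le> gp (x i) (x j)"
    unfolding converges_iff by meson
  then show ?thesis using nhd_of_gp_ge[of x x r "r + 1" N] x by simp
qed

text \<open>The loss is \<open>4 * C\<close> for the change of representatives, \<open>2 * C\<close>
  for hyperbolicity through \<open>b\<close>, and 1 for the strict inequality in
  \<open>boundary_nhd\<close>.\<close>

lemma nhd_trans:
  assumes v: "v \<in> boundary M d z" and u: "u \<in> nhd v (r + 6 * C + 1)" and w: "w \<in> nhd u (r + 6 * C + 1)"
  shows "w \<in> nhd v r"
proof -
  have "u \<in> boundary M d z" "w \<in> boundary M d z" using u w by (auto simp: boundary_nhd_def)
  then obtain a b c where abc: "converges a" "v = cls a" "converges b" "u = cls b" "converges c" "w = cls c"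
    using v by (metis boundary_cases)
  obtain N where N: "\<And>i j. i \<ge> N \<Longrightarrow> j \<ge> N \<Longrightarrow> r + 2 * C + 1 \<le> gp (a i) (b j)"
    using gp_ge_of_nhd[OF abc(1,3), of "r + 6 * C + 1"] u abc by (auto simp: algebra_simps)
  obtain N' where N': "\<And>i j. i \<ge> N' \<Longrightarrow> j \<ge> N' \<Longrightarrow> r + 2 * C + 1 \<le> gp (b i) (c j)"
    using gp_ge_of_nhd[OF abc(3,5), of "r + 6 * C + 1"] w abc by (auto simp: algebra_simps)
  have "r + 1 \<le> gp (a i) (c j)" if "i \<ge> max N N'" "j \<ge> max N N'" for i j
    using gp_hyperbolic[of "a i" "c j" "b i"] N[of i i] N'[of i j] that abc
    by (simp add: converges_in)
  then have "cls c \<in> nhd (cls a) r"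
    by (intro nhd_of_gp_ge[OF abc(1,5), of r "r + 1" "max N N'"]) auto
  then show ?thesis using abc by simp
qed

text \<open>A basic neighbourhood need not be open, but the points having some basic neighbourhood
  inside it form an open set, because \<open>nhd_trans\<close> lets the radius be chosen again at
  nearby points.\<close>

lemma nhd_interior:
  assumes v: "v \<in> boundary M d z"
  obtains A where "openin (boundary_topology M d z) A" "v \<in> A" "A \<subseteq> nhd v r"
proof -
  \<comment> \<open>A positive radius, so that it is itself the witness for
    \<open>v \<in> A\<close>.\<close>
  define s where "s = max r 1"
  define A where "A = {w \<in> boundary M d z. \<exists>t>0. nhd w t \<subseteq> nhd v s}"
  have "\<exists>t>0. nhd w t \<subseteq> A" if w: "w \<in> A" for w
  proof -
    obtain t where t: "t > 0" "nhd w t \<subseteq> nhd v s" using w by (auto simp: A_def)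
    have t': "t + 6 * C + 1 > 0" using t C_nonneg by simp
    have "u \<in> A" if u: "u \<in> nhd w (t + 6 * C + 1)" for u
    proof -
      have "nhd u (t + 6 * C + 1) \<subseteq> nhd v s"
        using nhd_trans[of w u t] u w t by (auto simp: A_def)
      then show ?thesis using t' u by (auto simp: A_def boundary_nhd_def)
    qed
    then show ?thesis using t' by blast
  qed
  then have "openin (boundary_topology M d z) A"
    by (auto simp: openin_boundary_topology A_def)
  moreover have "v \<in> A" using v by (auto simp: A_def s_def intro!: exI[of _ "max r 1"])
  moreover have "A \<subseteq> nhd v r"
  proof
    fix w assume w: "w \<in> A"
    then have "w \<in> nhd v s" using nhd_refl unfolding A_def by blast
    then show "w \<in> nhd v r"
      by (rule subsetD[OF boundary_nhd_antimono, rotated]) (simp add: s_def)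
  qed
  ultimately show thesis by (rule that)
qed

text \<open>A lower bound on \<open>H (x i) z\<close> passes to every \<open>y\<close> close to
  \<open>x\<close>, with \<open>c\<close> depending on \<open>x\<close> only; given such bounds, a
  large \<open>gp\<close> forces a large \<open>H\<close>.\<close>

lemma H_ge_of_nhd_high:
  assumes x: "high x"
  obtains c where "\<And>r y. c < r \<Longrightarrow> converges y \<Longrightarrow> cls y \<in> nhd (cls x) r \<Longrightarrow>
    high y \<and> (\<exists>N. \<forall>i\<ge>N. \<forall>j\<ge>N. r - c \<le> H (x i) (y j))"
proof -
  obtain K N1 where K: "\<And>i. i \<ge> N1 \<Longrightarrow> K \<le> H (x i) z" using x by (rule high_bounded) blast
  \<comment> \<open>The first entry makes \<open>H_base_ge_of_gp\<close> applicable, the second is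
    the loss in \<open>gp_le\<close> with the bound \<open>K - C\<close>; both include the
    \<open>4 * C\<close> from the change of representatives.\<close>
  define c where "c = max (B z + 5 * C - K) (B z + 6 * C - 2 * K)"
  have "high y \<and> (\<exists>N. \<forall>i\<ge>N. \<forall>j\<ge>N. r - c \<le> H (x i) (y j))"
    if r: "c < r" and y: "converges y" and nhd: "cls y \<in> nhd (cls x) r" for r y
  proof -
    have m: "x i \<in> M" "y i \<in> M" for i using x y by (auto simp: high_def converges_in)
    have "converges x" using x high_iff by blast
    from gp_ge_of_nhd[OF this y nhd] obtain N
      where N: "\<And>i j. i \<ge> N \<Longrightarrow> j \<ge> N \<Longrightarrow> r - 4 * C \<le> gp (x i) (y j)" by blast
    define N2 where "N2 = max N N1"
    have yK: "K - C \<le> H (y j) z" if "j \<ge> N2" for j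
      using N[of N2 j] K[of N2] m r that gp_commute[of "x N2"]
      by (intro H_base_ge_of_gp[of _ "x N2"]) (auto simp: N2_def c_def)
    have "\<not> low y"
    proof
      assume "low y"
      then obtain N3 where "\<And>i. i \<ge> N3 \<Longrightarrow> H (y i) z \<le> K - C - 1" unfolding low_def by meson
      from this[of "max N2 N3"] yK[of "max N2 N3"] show False by simp
    qed
    moreover have "r - c \<le> H (x i) (y j)" if "i \<ge> N2" "j \<ge> N2" for i j
      using N[of i j] gp_le[of "x i" "y j" "K - C"] K[of i] yK[of j] C_nonneg m that
      by (auto simp: N2_def c_def)
    ultimately show ?thesis using y converges_iff_low_or_high by blast
  qed
  then show thesis by (rule that)
qed

lemma nhd_high_of_H_ge:
  assumes "high x" "high y" "r + B z < s" "\<And>i j. i \<ge> N \<Longrightarrow> j \<ge> N \<Longrightarrow> s \<le> H (x i) (y j)"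
  shows "cls y \<in> nhd (cls x) r"
proof (rule nhd_of_gp_ge)
  show "r < s - B z" using assms by simp
  show "s - B z \<le> gp (x i) (y j)" if "i \<ge> N" "j \<ge> N" for i j
    using assms(4)[OF that] gp_ge[of "x i" "y j"] assms(1,2) by (force simp: high_def)
qed (use assms high_iff in auto)

text \<open>Against a low sequence that is already far below \<open>y\<close>, the Gromov product is
  at most \<open>B z + C - H (y j) z\<close> by \<open>gp_le_of_separated\<close>.\<close>

lemma H_le_of_nhd_apex:
  assumes y: "high y" and nhd: "cls y \<in> nhd apex r"
  shows "\<exists>N. \<forall>j\<ge>N. H (y j) z \<le> B z + 5 * C - r"
proof -
  obtain g where g: "low g" using exists_low by blast
  then have "converges g" "converges y" using y converges_iff_low_or_high by auto
  then obtain N where N: "\<And>i j. i \<ge> N \<Longrightarrow> j \<ge> N \<Longrightarrow> r - 4 * C \<le> gp (g i) (y j)"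
    using gp_ge_of_nhd[of g y r] nhd cls_low[OF g] by auto
  obtain K N1 where K: "\<And>i. i \<ge> N1 \<Longrightarrow> K \<le> H (y i) z" using y by (rule high_bounded) blast
  obtain N2 where N2: "\<And>i. i \<ge> N2 \<Longrightarrow> H (g i) z \<le> K - C - 1" using g unfolding low_def by meson
  have "H (y j) z \<le> B z + 5 * C - r" if "j \<ge> max N N1" for j
  proof -
    define i where "i = max N N2"
    have "gp (g i) (y j) \<le> B z + C - H (y j) z"
      using N2[of i] K[of j] that g y
      by (intro gp_le_of_separated) (auto simp: low_def high_def i_def)
    then show ?thesis using N[of i j] that by (simp add: i_def)
  qed
  then show ?thesis by blast
qed

text \<open>Late terms of a high sequence have large \<open>H\<close> with each other, so a bound on
  \<open>H (y j) z\<close> at one late index extends to all late ones at cost \<open>C\<close>.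
  Hence infinitely many good indices suffice, which is what a choice between two coordinates
  provides.\<close>

lemma nhd_apex_of_H_le:
  assumes y: "high y" and freq: "\<And>N. \<exists>j\<ge>N. H (y j) z \<le> K" and r: "r + 2 * C + K < B z"
  shows "cls y \<in> nhd apex r"
proof -
  obtain g where g: "low g" using exists_low by blast
  then have conv: "converges g" "converges y" using y converges_iff_low_or_high by auto
  then have m: "g i \<in> M" "y i \<in> M" for i by (auto intro: converges_in)
  obtain N0 where N0: "\<And>i j. i \<ge> N0 \<Longrightarrow> j \<ge> N0 \<Longrightarrow> K + C + 1 \<le> H (y i) (y j)"
    using y unfolding high_def by meson
  obtain j0 where j0: "j0 \<ge> N0" "H (y j0) z \<le> K" using freq by blast
  have yK: "H (y i) z \<le> K + C" if "i \<ge> N0" for i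
    using N0[OF j0(1) that] j0(2) horo_ultra[OF m(2) z m(2), of j0 i] by simp
  obtain N1 where N1: "\<And>i. i \<ge> N1 \<Longrightarrow> H (g i) z \<le> K + C" using g unfolding low_def by meson
  have "B z - 2 * C - K \<le> gp (g i) (y j)" if "i \<ge> max N0 N1" "j \<ge> max N0 N1" for i j
    using gp_ge_max[OF m, of i j] yK[of j] N1[of i] that by simp
  then show ?thesis
    using nhd_of_gp_ge[OF conv, of r "B z - 2 * C - K" "max N0 N1"] r cls_low[OF g] by simp
qed

text \<open>Allows moving the terms of a high sequence without changing its class. The ultrametric
  inequality is used once to compare \<open>y i\<close> with \<open>x j\<close> and once more to
  compare \<open>y i\<close> with \<open>y j\<close>.\<close>

lemma high_of_close:
  assumes x: "high x" and y: "range y \<subseteq> M" and close: "\<And>R. \<exists>N. \<forall>i\<ge>N. R \<le> H (x i) (y i)"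
  shows "high y" "cls y = cls x"
proof -
  have m: "x i \<in> M" "y i \<in> M" for i using x y by (auto simp: high_def)
  have "\<exists>N. \<forall>i\<ge>N. \<forall>j\<ge>N. R + C \<le> H (y i) (x j) \<and> R \<le> H (y i) (y j)" for R
  proof -
    obtain N where N: "\<And>i j. i \<ge> N \<Longrightarrow> j \<ge> N \<Longrightarrow> R + 2 * C \<le> H (x i) (x j)"
      using x unfolding high_def by meson
    obtain N' where N': "\<And>i. i \<ge> N' \<Longrightarrow> R + 2 * C \<le> H (x i) (y i)"
      using close by meson
    have "R + C \<le> H (y i) (x j) \<and> R \<le> H (y i) (y j)" if "i \<ge> max N N'" "j \<ge> max N N'" for i j
    proof -
      have *: "R + C \<le> H (y i) (x j)"
        using horo_ultra[OF m(2) m(1) m(1), of i i j] N[of i j] N'[of i] that H_commute[of "x i" "y i"]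
        by simp
      moreover have "R \<le> H (y i) (y j)"
        using horo_ultra[OF m(2) m(2) m(1), of i j j] * N'[of j] C_nonneg that by simp
      ultimately show ?thesis by blast
    qed
    then show ?thesis by blast
  qed
  note * = this
  show "high y" using * y unfolding high_def by meson
  have "\<exists>N. \<forall>i\<ge>N. \<forall>j\<ge>N. R \<le> H (y i) (x j)" for R
    using *[of "R - C"] by auto
  then show "cls y = cls x" using cls_eq_iff_high[OF \<open>high y\<close> x] by blast
qed

text \<open>By \<open>H_ge_of_nhd_high\<close>, classes close enough to a high one are high. This
  keeps small boxes in the product of the boundaries off the wedge.\<close>

lemma nhd_avoids_apex:
  assumes "high x"
  obtains s where "0 < s" "apex \<notin> nhd (cls x) s"
proof -
  obtain c where c: "\<And>r y. c < r \<Longrightarrow> converges y \<Longrightarrow> cls y \<in> nhd (cls x) r \<Longrightarrow>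
      high y \<and> (\<exists>N. \<forall>i\<ge>N. \<forall>j\<ge>N. r - c \<le> H (x i) (y j))"
    using assms by (rule H_ge_of_nhd_high) blast
  obtain g where g: "low g" using exists_low by blast
  have "apex \<notin> nhd (cls x) (max 1 (c + 1))"
    using c[of "max 1 (c + 1)" g] g cls_low[OF g] not_low_and_high[OF g]
    by (auto simp: converges_iff_low_or_high)
  then show thesis by (rule that[rotated]) simp
qed

end


section \<open>Busemann functions\<close>

locale busemann_ray = Metric_space M d for M :: "'a set" and d +
  fixes \<gamma> :: "real \<Rightarrow> 'a" and k :: real
  assumes k_nonneg: "0 \<le> k" and ray: "rough_isometric_on M d k {0..} \<gamma>"
begin

abbreviation b :: "'a \<Rightarrow> real" where "b \<equiv> busemann d \<gamma>"

lemma ray_in: "0 \<le> t \<Longrightarrow> \<gamma> t \<in> M"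
  using ray by (auto simp: rough_isometric_on_def)

lemma ray_dist: "0 \<le> s \<Longrightarrow> 0 \<le> t \<Longrightarrow> \<bar>d (\<gamma> s) (\<gamma> t) - \<bar>s - t\<bar>\<bar> \<le> k"
  using ray by (force simp: rough_isometric_on_def abs_le_iff)

text \<open>For a genuine geodesic ray this is monotonicity of \<open>d x (\<gamma> t) - t\<close>;
  roughness costs \<open>k\<close>. It makes the lower limit a limit up to a bounded error.\<close>

lemma ray_decreasing:
  assumes "x \<in> M" "0 \<le> s" "s \<le> t"
  shows "d x (\<gamma> t) - t \<le> d x (\<gamma> s) - s + k"
  using triangle[of x "\<gamma> s" "\<gamma> t"] ray_in[of s] ray_in[of t] ray_dist[of s t] assms by auto

lemma ray_lower:
  assumes "x \<in> M" "0 \<le> t"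
  shows "- d x (\<gamma> 0) - k \<le> d x (\<gamma> t) - t"
  using triangle[of "\<gamma> 0" x "\<gamma> t"] ray_in[of 0] ray_in[of t] ray_dist[of 0 t] commute[of x "\<gamma> 0"] assms
  by auto

text \<open>Both bounds are finite, so \<open>real_of_ereal\<close>, which would send an infinite
  value to 0, returns the actual lower limit.\<close>

lemma ereal_busemann:
  assumes x: "x \<in> M"
  shows "Liminf at_top (\<lambda>t. ereal (d x (\<gamma> t) - t)) = ereal (b x)"
proof -
  let ?L = "Liminf at_top (\<lambda>t. ereal (d x (\<gamma> t) - t))"
  have "ereal (- d x (\<gamma> 0) - k) \<le> ?L"
    by (rule Liminf_bounded)
      (use eventually_ge_at_top[of 0] in \<open>eventually_elim, use ray_lower[OF x] in simp\<close>)
  moreover have "?L \<le> Liminf at_top (\<lambda>t::real. ereal (d x (\<gamma> 0) + k))"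
    by (rule Liminf_mono)
      (use eventually_ge_at_top[of 0] in \<open>eventually_elim, use ray_decreasing[OF x, of 0] in simp\<close>)
  ultimately show ?thesis
    unfolding busemann_def by (cases ?L) (auto simp: Liminf_const)
qed

lemma eventually_gt_busemann:
  assumes "x \<in> M" "0 < e"
  shows "\<forall>\<^sub>F t in at_top. b x - e < d x (\<gamma> t) - t"
proof -
  have "ereal (b x - e) < Liminf at_top (\<lambda>t. ereal (d x (\<gamma> t) - t))"
    using assms by (simp add: ereal_busemann)
  from less_LiminfD[OF this] show ?thesis by simp
qed

lemma frequently_lt_busemann:
  assumes "x \<in> M" "0 < e"
  obtains t where "T \<le> t" "d x (\<gamma> t) - t < b x + e"
proof (rule ccontr)
  assume "\<not> thesis"
  then have "\<And>t. T \<le> t \<Longrightarrow> b x + e \<le> d x (\<gamma> t) - t" using that not_le by blast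
  then have "ereal (b x + e) \<le> Liminf at_top (\<lambda>t. ereal (d x (\<gamma> t) - t))"
    by (intro Liminf_bounded) (use eventually_ge_at_top[of T] in \<open>eventually_elim, simp\<close>)
  then show False using assms by (simp add: ereal_busemann)
qed

lemma busemann_le:
  assumes x: "x \<in> M" and t: "0 \<le> t"
  shows "b x \<le> d x (\<gamma> t) - t + k + 1"
proof -
  have "\<forall>\<^sub>F s in at_top. b x - 1 < d x (\<gamma> s) - s \<and> t \<le> s"
    using eventually_gt_busemann[OF x, of 1] eventually_ge_at_top by (auto intro: eventually_conj)
  then obtain s where "b x - 1 < d x (\<gamma> s) - s" "t \<le> s"
    by (auto simp: eventually_at_top_linorder)
  then show ?thesis using ray_decreasing[OF x t, of s] by linarith
qed

text \<open>Once the function comes within 1 of its lower limit, it cannot rise by more than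
  \<open>k\<close> afterwards.\<close>

lemma eventually_busemann:
  assumes x: "x \<in> M"
  shows "\<forall>\<^sub>F t in at_top. \<bar>d x (\<gamma> t) - t - b x\<bar> \<le> k + 1"
proof -
  obtain s where s: "0 \<le> s" "d x (\<gamma> s) - s < b x + 1"
    by (rule frequently_lt_busemann[OF x zero_less_one])
  show ?thesis
    using eventually_ge_at_top[of s]
  proof eventually_elim
    case (elim t)
    then show ?case using ray_decreasing[OF x s(1), of t] busemann_le[OF x, of t] s by linarith
  qed
qed

text \<open>There is no additive error: only the triangle inequality is used, at a late time where
  the value for \<open>y\<close> is almost its lower limit.\<close>

lemma busemann_le_dist:
  assumes "x \<in> M" "y \<in> M"
  shows "b x \<le> b y + d x y"
proof (rule field_le_epsilon)
  fix e :: real assume e: "0 < e"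
  obtain T where T: "\<And>t. T \<le> t \<Longrightarrow> b x - e / 2 < d x (\<gamma> t) - t"
    using eventually_gt_busemann[OF assms(1), of "e / 2"] e by (auto simp: eventually_at_top_linorder)
  obtain t where t: "max T 0 \<le> t" "d y (\<gamma> t) - t < b y + e / 2"
    using frequently_lt_busemann[OF assms(2) half_gt_zero[OF e]] by blast
  show "b x \<le> b y + d x y + e"
    using T[of t] t triangle[of x y "\<gamma> t"] assms ray_in[of t] by auto
qed

lemma horospherical_busemann:
  assumes geo: "roughly_geodesic M d" and hyp: "gromov_hyperbolic M d"
  obtains C where "horospherical M d b C"
proof -
  obtain l where l: "0 \<le> l" and geo: "\<And>x y. x \<in> M \<Longrightarrow> y \<in> M \<Longrightarrow> \<exists>\<alpha> \<omega> \<sigma>.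
      \<alpha> \<le> \<omega> \<and> rough_isometric_on M d l {\<alpha>..\<omega>} \<sigma> \<and> \<sigma> \<alpha> = x \<and> \<sigma> \<omega> = y"
    using geo unfolding roughly_geodesic_def by blast
  obtain \<delta> where \<delta>: "0 \<le> \<delta>" and hyp: "\<And>x y u w. x \<in> M \<Longrightarrow> y \<in> M \<Longrightarrow> u \<in> M \<Longrightarrow> w \<in> M \<Longrightarrow>
     d x y + d u w \<le> max (d x u + d y w) (d x w + d y u) + 2 * \<delta>"
    using hyp unfolding gromov_hyperbolic_def by blast
  \<comment> \<open>The ultrametric inequality costs \<open>\<delta> + k + 1\<close> and the descent
    \<open>2 * l + k + 2\<close>; \<open>C\<close> covers both.\<close>
  define C where "C = \<delta> + 2 * l + k + 2"
  have "horospherical M d b C"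
  proof
    show "0 \<le> C" using l \<delta> k_nonneg by (simp add: C_def)
    show "b x \<le> b y + d x y" if "x \<in> M" "y \<in> M" for x y
      using that by (rule busemann_le_dist)
  next
    fix x y w assume m: "x \<in> M" "y \<in> M" "w \<in> M"
    have "\<forall>\<^sub>F t in at_top. \<bar>d x (\<gamma> t) - t - b x\<bar> \<le> k + 1 \<and> \<bar>d y (\<gamma> t) - t - b y\<bar> \<le> k + 1 \<and>
        \<bar>d w (\<gamma> t) - t - b w\<bar> \<le> k + 1 \<and> 0 \<le> t"
      using eventually_busemann[OF m(1)] eventually_busemann[OF m(2)] eventually_busemann[OF m(3)]
        eventually_ge_at_top by (intro eventually_conj) auto
    then obtain t where t: "\<bar>d x (\<gamma> t) - t - b x\<bar> \<le> k + 1" "\<bar>d y (\<gamma> t) - t - b y\<bar> \<le> k + 1"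
        "\<bar>d w (\<gamma> t) - t - b w\<bar> \<le> k + 1" "0 \<le> t"
      by (auto simp: eventually_at_top_linorder)
    have four: "d x y + d w (\<gamma> t) \<le> max (d x w + d y (\<gamma> t)) (d x (\<gamma> t) + d y w) + 2 * \<delta>"
      by (rule hyp) (use m ray_in t in auto)
    \<comment> \<open>Each side of \<open>four\<close> contains one distance to
      \<open>\<gamma> t\<close>, so \<open>t\<close> cancels, and replacing these distances by
      \<open>b\<close> costs \<open>k + 1\<close> on each side.\<close>
    have "d x y + b w \<le> d x w + b y + 2 * (\<delta> + k + 1) \<or> d x y + b w \<le> b x + d y w + 2 * (\<delta> + k + 1)"
      using four t(1,2,3) unfolding abs_le_iff max_def by (auto split: if_splits)
    then have "horo_product d b x w \<le> horo_product d b x y + C \<or> horo_product d b w y \<le> horo_product d b x y + C"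
      using l commute[of w y] unfolding C_def horo_product_def by (auto simp: field_simps)
    then show "min (horo_product d b x w) (horo_product d b w y) \<le> horo_product d b x y + C"
      by (auto simp: min_le_iff_disj)
  next
    fix x t assume x: "x \<in> M" and t: "0 \<le> (t :: real)"
    \<comment> \<open>The point \<open>\<gamma> T\<close> is so far away that a rough geodesic from
      \<open>x\<close> to it lasts at least time \<open>t\<close>, and \<open>T\<close> is a time at
      which the lower limit is attained up to 1.\<close>
    obtain T where T: "max 0 (t + k + l + d x (\<gamma> 0)) \<le> T" "d x (\<gamma> T) - T < b x + 1"
      by (rule frequently_lt_busemann[OF x zero_less_one])
    then have T0: "0 \<le> T" by simp
    obtain \<alpha> \<omega> \<sigma> where \<sigma>: "\<alpha> \<le> \<omega>" "rough_isometric_on M d l {\<alpha>..\<omega>} \<sigma>" "\<sigma> \<alpha> = x" "\<sigma> \<omega> = \<gamma> T"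
      using geo[OF x ray_in[OF T0]] by blast
    have \<sigma>_dist: "\<bar>s - u\<bar> - l \<le> d (\<sigma> s) (\<sigma> u)" "d (\<sigma> s) (\<sigma> u) \<le> \<bar>s - u\<bar> + l"
      if "s \<in> {\<alpha>..\<omega>}" "u \<in> {\<alpha>..\<omega>}" for s u
      using \<sigma>(2) that unfolding rough_isometric_on_def by blast+
    have len: "\<bar>d x (\<gamma> T) - (\<omega> - \<alpha>)\<bar> \<le> l"
      using \<sigma>_dist[of \<alpha> \<omega>] \<sigma> by auto
    have in_dom: "\<alpha> + t \<in> {\<alpha>..\<omega>}"
      using len ray_lower[OF x T0] T t by auto
    define p where "p = \<sigma> (\<alpha> + t)"
    have p: "p \<in> M" using in_dom \<sigma>(2) by (auto simp: p_def rough_isometric_on_def)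
    have xp: "\<bar>d x p - t\<bar> \<le> l"
      using \<sigma>_dist[of \<alpha> "\<alpha> + t"] in_dom \<sigma> t by (auto simp: p_def)
    have "d p (\<gamma> T) \<le> \<omega> - \<alpha> - t + l"
      using \<sigma>_dist[of "\<alpha> + t" \<omega>] in_dom \<sigma> t by (auto simp: p_def)
    then have "b p \<le> b x - t + C"
      using busemann_le[OF p T0] len T \<delta> unfolding C_def by linarith
    moreover have "b x - t - C \<le> b p"
      using busemann_le_dist[OF x p] xp l \<delta> k_nonneg unfolding C_def by linarith
    moreover have "\<bar>d x p - t\<bar> \<le> C" using xp l \<delta> k_nonneg unfolding C_def by linarith
    ultimately show "\<exists>p\<in>M. \<bar>d x p - t\<bar> \<le> C \<and> \<bar>b p - (b x - t)\<bar> \<le> C"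
      using p by (intro bexI[of _ p]) auto
  qed
  then show thesis by (rule that)
qed

end


section \<open>The product along the Busemann functions\<close>

text \<open>Descents to a common level in the two factors miss it by at most \<open>C1\<close> and
  \<open>C2\<close>. The condition on \<open>\<Delta>\<close> says that the resulting pairs lie in
  \<open>Y\<close>; it is the source of the threshold in the theorem.\<close>

locale busemann_pair =
  X1: based_horospherical M1 d1 "busemann d1 \<gamma>1" C1 z1 +
  X2: based_horospherical M2 d2 "busemann d2 \<gamma>2" C2 z2
  for M1 :: "'a set" and d1 \<gamma>1 C1 z1 and M2 :: "'b set" and d2 \<gamma>2 C2 z2 +
  fixes \<Delta> :: real
  assumes \<Delta>: "C1 + C2 \<le> \<Delta>"
begin

abbreviation "B1 \<equiv> busemann d1 \<gamma>1"
abbreviation "B2 \<equiv> busemann d2 \<gamma>2"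
abbreviation "Y \<equiv> busemann_product M1 d1 \<gamma>1 M2 d2 \<gamma>2 \<Delta>"
abbreviation "dm \<equiv> max_dist d1 d2"
text \<open>On \<open>Y\<close> the two Busemann functions differ by at most
  \<open>\<Delta>\<close>, so the first one can stand for both.\<close>

abbreviation "BY \<equiv> \<lambda>p :: 'a \<times> 'b. B1 (fst p)"
abbreviation "HY \<equiv> horo_product dm BY"

lemma in_Y: "p \<in> Y \<longleftrightarrow> fst p \<in> M1 \<and> snd p \<in> M2 \<and> \<bar>B1 (fst p) - B2 (snd p)\<bar> \<le> \<Delta>"
  by (cases p) (simp add: busemann_product_def)

lemma dm_eq: "dm p q = max (d1 (fst p) (fst q)) (d2 (snd p) (snd q))"
  by (simp add: max_dist_def split: prod.splits)

lemma in_Y_of_level: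
  assumes "p1 \<in> M1" "p2 \<in> M2" "\<bar>B1 p1 - l\<bar> \<le> C1" "\<bar>B2 p2 - l\<bar> \<le> C2"
  shows "(p1, p2) \<in> Y"
  using assms \<Delta> by (simp add: in_Y)

text \<open>Distances enter \<open>H\<close> with a minus sign, so their maximum turns into the
  minimum of the two \<open>H\<close>. Replacing \<open>B2\<close> by \<open>B1\<close> at both
  points costs at most \<open>2 * \<Delta>\<close>, which is then halved.\<close>

lemma HY_approx:
  assumes "p \<in> Y" "q \<in> Y"
  shows "\<bar>HY p q - min (X1.H (fst p) (fst q)) (X2.H (snd p) (snd q))\<bar> \<le> \<Delta>"
proof -
  have "2 * HY p q = B1 (fst p) + B1 (fst q) - max (d1 (fst p) (fst q)) (d2 (snd p) (snd q))"
    by (simp add: horo_product_def dm_eq)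
  then show ?thesis
    using assms X1.dist_eq[of "fst p" "fst q"] X2.dist_eq[of "snd p" "snd q"] \<Delta> X1.C_nonneg X2.C_nonneg
    unfolding in_Y abs_le_iff min_def max_def by (auto split: if_splits)
qed

text \<open>An ultrametric inequality up to a constant passes to minima.\<close>

lemma horospherical_Y: "horospherical Y dm BY (3 * \<Delta>)"
proof -
  interpret Y: Metric_space Y dm
    by (rule Metric_space_busemann_product) (rule X1.Metric_space_axioms X2.Metric_space_axioms)+
  have \<Delta>0: "0 \<le> \<Delta>" using \<Delta> X1.C_nonneg X2.C_nonneg by simp
  show ?thesis
  proof
    show "0 \<le> 3 * \<Delta>" using \<Delta>0 by simp
    fix p q assume pq: "p \<in> Y" "q \<in> Y"
    then show "BY p \<le> BY q + dm p q"
      using X1.B_le[of "fst p" "fst q"] by (simp add: in_Y dm_eq)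
  next
    fix p q w assume m: "p \<in> Y" "q \<in> Y" "w \<in> Y"
    have "min (X1.H (fst p) (fst w)) (X1.H (fst w) (fst q)) \<le> X1.H (fst p) (fst q) + C1"
      using m by (intro X1.horo_ultra) (auto simp: in_Y)
    moreover have "min (X2.H (snd p) (snd w)) (X2.H (snd w) (snd q)) \<le> X2.H (snd p) (snd q) + C2"
      using m by (intro X2.horo_ultra) (auto simp: in_Y)
    ultimately have "min (min (X1.H (fst p) (fst w)) (X2.H (snd p) (snd w)))
        (min (X1.H (fst w) (fst q)) (X2.H (snd w) (snd q)))
      \<le> min (X1.H (fst p) (fst q)) (X2.H (snd p) (snd q)) + \<Delta>"
      using \<Delta> X1.C_nonneg X2.C_nonneg by (auto simp: min_le_iff_disj)
    then show "min (HY p w) (HY w q) \<le> HY p q + 3 * \<Delta>"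
      using HY_approx[OF m(1,3)] HY_approx[OF m(3,2)] HY_approx[OF m(1,2)]
      unfolding abs_le_iff by linarith
  next
    fix p :: "'a \<times> 'b" and t :: real assume p: "p \<in> Y" and t: "0 \<le> t"
    then have m: "fst p \<in> M1" "snd p \<in> M2" by (auto simp: in_Y)
    \<comment> \<open>The coordinates start at levels differing by \<open>e\<close>. Letting the
      second one descend for time \<open>t - e\<close> brings both to the level
      \<open>B1 (fst p) - t\<close>.\<close>
    define e where "e = B1 (fst p) - B2 (snd p)"
    have e: "\<bar>e\<bar> \<le> \<Delta>" using p by (simp add: in_Y e_def)
    show "\<exists>q\<in>Y. \<bar>dm p q - t\<bar> \<le> 3 * \<Delta> \<and> \<bar>BY q - (BY p - t)\<bar> \<le> 3 * \<Delta>"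
    proof (cases "e \<le> t")
      case True
      obtain q1 where q1: "q1 \<in> M1" "\<bar>d1 (fst p) q1 - t\<bar> \<le> C1" "\<bar>B1 q1 - (B1 (fst p) - t)\<bar> \<le> C1"
        using X1.descend[OF m(1) t] by blast
      obtain q2 where q2: "q2 \<in> M2" "\<bar>d2 (snd p) q2 - (t - e)\<bar> \<le> C2"
          "\<bar>B2 q2 - (B2 (snd p) - (t - e))\<bar> \<le> C2"
        using X2.descend[OF m(2), of "t - e"] True by auto
      have "(q1, q2) \<in> Y"
        using q1(1) q2(1) q1(3) by (rule in_Y_of_level) (use q2(3) in \<open>simp add: e_def\<close>)
      moreover have "\<bar>dm p (q1, q2) - t\<bar> \<le> 3 * \<Delta>"
        using q1(2) q2(2) e \<Delta> X1.C_nonneg X2.C_nonneg by (auto simp: dm_eq max_def)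
      moreover have "\<bar>BY (q1, q2) - (BY p - t)\<bar> \<le> 3 * \<Delta>"
        using q1(3) \<Delta>0 \<Delta> X2.C_nonneg by simp
      ultimately show ?thesis by blast
    next
      case False
      \<comment> \<open>Here \<open>t\<close> is less than \<open>e\<close>, hence less than
        \<open>\<Delta>\<close>, and \<open>p\<close> itself serves as the descended point.\<close>
      have "dm p p = 0" using p by simp
      then show ?thesis using False e t \<Delta>0 p by (intro bexI[of _ p]) auto
    qed
  qed
qed

lemma Y_nonempty: "Y \<noteq> {}"
proof -
  obtain p1 where "p1 \<in> M1" "\<bar>B1 p1 - min (B1 z1) (B2 z2)\<bar> \<le> C1"
    using X1.descend_to[OF X1.z, of "min (B1 z1) (B2 z2)"] by auto
  moreover obtain p2 where "p2 \<in> M2" "\<bar>B2 p2 - min (B1 z1) (B2 z2)\<bar> \<le> C2"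
    using X2.descend_to[OF X2.z, of "min (B1 z1) (B2 z2)"] by auto
  ultimately show ?thesis using in_Y_of_level by blast
qed

end

text \<open>The product has its own base point, since \<open>(z1, z2)\<close> need not lie in
  \<open>Y\<close>.\<close>

locale based_busemann_pair = busemann_pair +
  fixes z assumes z_in_Y: "z \<in> busemann_product M1 d1 \<gamma>1 M2 d2 \<gamma>2 \<Delta>"
begin

sublocale Y: based_horospherical Y dm BY "3 * \<Delta>" z
  by (intro based_horospherical.intro horospherical_Y based_horospherical_axioms.intro z_in_Y)

text \<open>The error of \<open>HY_approx\<close> plus the cost of moving the base points of the
  factors to the coordinates of \<open>z\<close>.\<close>

definition D :: real where "D = \<Delta> + d1 z1 (fst z) + d2 z2 (snd z)"

lemma HY_base_approx:
  assumes "p \<in> Y"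
  shows "\<bar>HY p z - min (X1.H (fst p) z1) (X2.H (snd p) z2)\<bar> \<le> D"
proof -
  have m: "fst p \<in> M1" "fst z \<in> M1" "snd p \<in> M2" "snd z \<in> M2"
    using assms z_in_Y by (auto simp: in_Y)
  show ?thesis
    using HY_approx[OF assms z_in_Y] X1.H_base_change[OF m(1) X1.z m(2)]
      X2.H_base_change[OF m(3) X2.z m(4)] X1.nonneg[of z1 "fst z"] X2.nonneg[of z2 "snd z"]
    unfolding D_def abs_le_iff min_def by (auto split: if_splits)
qed

section \<open>Sequences in the product and their coordinates\<close>

lemma in_M:
  assumes "range x \<subseteq> Y"
  shows "x i \<in> Y" "fst (x i) \<in> M1" "snd (x i) \<in> M2"
proof -
  show "x i \<in> Y" using assms by blast
  then show "fst (x i) \<in> M1" "snd (x i) \<in> M2" by (simp_all add: in_Y)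
qed

text \<open>Up to a bounded error \<open>HY\<close> is a minimum, and a minimum tends to infinity
  iff both terms do.\<close>

lemma HY_tendsto_iff:
  fixes x y :: "nat \<Rightarrow> 'a \<times> 'b"
  assumes x: "range x \<subseteq> Y" and y: "range y \<subseteq> Y"
  shows "(\<forall>R. \<exists>N. \<forall>i\<ge>N. \<forall>j\<ge>N. R \<le> HY (x i) (y j)) \<longleftrightarrow>
    (\<forall>R. \<exists>N. \<forall>i\<ge>N. \<forall>j\<ge>N. R \<le> X1.H ((fst \<circ> x) i) ((fst \<circ> y) j)) \<and>
    (\<forall>R. \<exists>N. \<forall>i\<ge>N. \<forall>j\<ge>N. R \<le> X2.H ((snd \<circ> x) i) ((snd \<circ> y) j))" (is "?L \<longleftrightarrow> ?R1 \<and> ?R2")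
proof
  assume L: ?L
  have "\<exists>N. \<forall>i\<ge>N. \<forall>j\<ge>N. R \<le> X1.H ((fst \<circ> x) i) ((fst \<circ> y) j) \<and>
      R \<le> X2.H ((snd \<circ> x) i) ((snd \<circ> y) j)" for R
  proof -
    obtain N where N: "\<And>i j. i \<ge> N \<Longrightarrow> j \<ge> N \<Longrightarrow> R + \<Delta> \<le> HY (x i) (y j)" using L by meson
    have "R \<le> X1.H ((fst \<circ> x) i) ((fst \<circ> y) j) \<and> R \<le> X2.H ((snd \<circ> x) i) ((snd \<circ> y) j)"
      if "i \<ge> N" "j \<ge> N" for i j
      using N[OF that] HY_approx[OF in_M(1)[OF x, of i] in_M(1)[OF y, of j]]
      by (auto simp: abs_le_iff min_def split: if_splits)
    then show ?thesis by blast
  qed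
  then show "?R1 \<and> ?R2" by meson
next
  assume R: "?R1 \<and> ?R2"
  show ?L
  proof
    fix R
    obtain N where N: "\<And>i j. i \<ge> N \<Longrightarrow> j \<ge> N \<Longrightarrow> R + \<Delta> \<le> X1.H (fst (x i)) (fst (y j))"
      using R unfolding o_def by meson
    obtain N' where N': "\<And>i j. i \<ge> N' \<Longrightarrow> j \<ge> N' \<Longrightarrow> R + \<Delta> \<le> X2.H (snd (x i)) (snd (y j))"
      using R unfolding o_def by meson
    have "R \<le> HY (x i) (y j)" if i: "i \<ge> max N N'" and j: "j \<ge> max N N'" for i j
    proof -
      have "R + \<Delta> \<le> X1.H (fst (x i)) (fst (y j))" "R + \<Delta> \<le> X2.H (snd (x i)) (snd (y j))"
        using N[of i j] N'[of i j] i j by auto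
      then show ?thesis
        using HY_approx[OF in_M(1)[OF x, of i] in_M(1)[OF y, of j]]
        by (auto simp: abs_le_iff min_def split: if_splits)
    qed
    then show "\<exists>N. \<forall>i\<ge>N. \<forall>j\<ge>N. R \<le> HY (x i) (y j)" by blast
  qed
qed

lemma Y_high_iff: "Y.high x \<longleftrightarrow> range x \<subseteq> Y \<and> X1.high (fst \<circ> x) \<and> X2.high (snd \<circ> x)"
proof (cases "range x \<subseteq> Y")
  case True
  then have "range (fst \<circ> x) \<subseteq> M1" "range (snd \<circ> x) \<subseteq> M2" using in_M by auto
  then show ?thesis
    using HY_tendsto_iff[OF True True] True
    by (simp only: Y.high_def X1.high_def X2.high_def simp_thms)
qed (simp add: Y.high_def)

lemma Y_cls_eq_iff:
  assumes "Y.high x" "Y.high y"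
  shows "Y.cls x = Y.cls y \<longleftrightarrow>
    X1.cls (fst \<circ> x) = X1.cls (fst \<circ> y) \<and> X2.cls (snd \<circ> x) = X2.cls (snd \<circ> y)"
proof -
  have x: "range x \<subseteq> Y" "X1.high (fst \<circ> x)" "X2.high (snd \<circ> x)"
    and y: "range y \<subseteq> Y" "X1.high (fst \<circ> y)" "X2.high (snd \<circ> y)"
    using assms by (simp_all add: Y_high_iff)
  show ?thesis
    unfolding Y.cls_eq_iff_high[OF assms] X1.cls_eq_iff_high[OF x(2) y(2)]
      X2.cls_eq_iff_high[OF x(3) y(3)] by (rule HY_tendsto_iff[OF x(1) y(1)])
qed

text \<open>
  Points \<open>x1 i\<close> and \<open>x2 i\<close> far from the centres are moved towards them, to the lower of the two
  levels \<open>B1 (x1 i)\<close>, \<open>B2 (x2 i)\<close>; as these levels tend to infinity, the classes do not change.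
\<close>

lemma exists_Y_high:
  assumes x1: "X1.high x1" and x2: "X2.high x2"
  obtains y where "Y.high y" "X1.cls (fst \<circ> y) = X1.cls x1" "X2.cls (snd \<circ> y) = X2.cls x2"
proof -
  have m: "x1 i \<in> M1" "x2 i \<in> M2" for i using x1 x2 by (auto simp: X1.high_def X2.high_def)
  define l where "l i = min (B1 (x1 i)) (B2 (x2 i))" for i
  have "\<exists>p\<in>M1. \<bar>B1 p - l i\<bar> \<le> C1 \<and> l i - C1 \<le> X1.H (x1 i) p" for i
    using X1.descend_to[OF m(1)[of i], of "l i"] by (metis l_def min.cobounded1)
  then obtain y1 where y1: "\<And>i. y1 i \<in> M1" "\<And>i. \<bar>B1 (y1 i) - l i\<bar> \<le> C1"
      "\<And>i. l i - C1 \<le> X1.H (x1 i) (y1 i)" by metis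
  have "\<exists>p\<in>M2. \<bar>B2 p - l i\<bar> \<le> C2 \<and> l i - C2 \<le> X2.H (x2 i) p" for i
    using X2.descend_to[OF m(2)[of i], of "l i"] by (metis l_def min.cobounded2)
  then obtain y2 where y2: "\<And>i. y2 i \<in> M2" "\<And>i. \<bar>B2 (y2 i) - l i\<bar> \<le> C2"
      "\<And>i. l i - C2 \<le> X2.H (x2 i) (y2 i)" by metis
  \<comment> \<open>The diagonal case of the definition of \<open>high\<close>, where
    \<open>H x x\<close> is \<open>B x\<close>.\<close>
  have l: "\<exists>N. \<forall>i\<ge>N. R \<le> l i" for R
  proof -
    obtain N where N: "\<And>i j. i \<ge> N \<Longrightarrow> j \<ge> N \<Longrightarrow> R \<le> X1.H (x1 i) (x1 j)"
      using x1 unfolding X1.high_def by meson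
    obtain N' where N': "\<And>i j. i \<ge> N' \<Longrightarrow> j \<ge> N' \<Longrightarrow> R \<le> X2.H (x2 i) (x2 j)"
      using x2 unfolding X2.high_def by meson
    have "R \<le> l i" if "i \<ge> max N N'" for i
      using N[of i i] N'[of i i] that X1.H_self[OF m(1)] X2.H_self[OF m(2)] by (simp add: l_def)
    then show ?thesis by blast
  qed
  have c1: "\<exists>N. \<forall>i\<ge>N. R \<le> X1.H (x1 i) (y1 i)" for R
    using l[of "R + C1"] y1(3) by (smt (verit))
  have c2: "\<exists>N. \<forall>i\<ge>N. R \<le> X2.H (x2 i) (y2 i)" for R
    using l[of "R + C2"] y2(3) by (smt (verit))
  define y where "y i = (y1 i, y2 i)" for i
  have proj: "fst \<circ> y = y1" "snd \<circ> y = y2" by (auto simp: y_def)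
  have "range y \<subseteq> Y"
    using in_Y_of_level[OF y1(1) y2(1) y1(2) y2(2)] by (auto simp: y_def)
  moreover have "range y1 \<subseteq> M1" "range y2 \<subseteq> M2" using y1(1) y2(1) by auto
  ultimately show thesis
    using X1.high_of_close[OF x1 _ c1] X2.high_of_close[OF x2 _ c2]
    by (intro that[of y]) (simp_all add: Y_high_iff proj)
qed


section \<open>The natural map from the boundary of the product\<close>

abbreviation "V \<equiv> wedge (boundary M1 d1 z1) X1.apex (boundary M2 d2 z2) X2.apex"

text \<open>Off the apex, any high representative gives the same value by
  \<open>Y_cls_eq_iff\<close>, and the singleton is what \<open>collapse\<close> returns off the
  wedge. For a low sequence only one coordinate need be near an apex, possibly a different one at
  each index, so the apex goes to \<open>V\<close> without reference to coordinates.\<close>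

definition f :: "(nat \<Rightarrow> 'a \<times> 'b) set \<Rightarrow> ((nat \<Rightarrow> 'a) set \<times> (nat \<Rightarrow> 'b) set) set" where
  "f w = (if w = Y.apex then V else
    let x = SOME x. Y.high x \<and> Y.cls x = w in {(X1.cls (fst \<circ> x), X2.cls (snd \<circ> x))})"

lemma f_apex: "f Y.apex = V"
  by (simp add: f_def)

lemma f_high:
  assumes "Y.high x"
  shows "f (Y.cls x) = {(X1.cls (fst \<circ> x), X2.cls (snd \<circ> x))}"
proof -
  define x' where "x' = (SOME x'. Y.high x' \<and> Y.cls x' = Y.cls x)"
  have "Y.high x' \<and> Y.cls x' = Y.cls x"
    unfolding x'_def by (rule someI[of _ x]) (simp add: assms)
  then have "X1.cls (fst \<circ> x') = X1.cls (fst \<circ> x)" "X2.cls (snd \<circ> x') = X2.cls (snd \<circ> x)"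
    using Y_cls_eq_iff[of x' x] assms by auto
  then show ?thesis
    using Y.cls_high[OF assms] by (simp add: f_def Let_def flip: x'_def)
qed

lemma Y_high_projections:
  assumes "Y.high x"
  shows "X1.high (fst \<circ> x)" "X2.high (snd \<circ> x)"
    "X1.cls (fst \<circ> x) \<in> boundary M1 d1 z1" "X2.cls (snd \<circ> x) \<in> boundary M2 d2 z2"
    "X1.cls (fst \<circ> x) \<noteq> X1.apex" "X2.cls (snd \<circ> x) \<noteq> X2.apex"
  using assms X1.high_iff X2.high_iff X1.cls_in_boundary X2.cls_in_boundary
  by (simp_all add: Y_high_iff)

lemma collapse_off_wedge:
  assumes "v1 \<noteq> X1.apex" "v2 \<noteq> X2.apex"
  shows "collapse V (v1, v2) = {(v1, v2)}" "{(v1, v2)} \<noteq> V"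
proof -
  have "(v1, v2) \<notin> V" using assms by (auto simp: wedge_def)
  then show "collapse V (v1, v2) = {(v1, v2)}" "{(v1, v2)} \<noteq> V"
    by (auto simp: collapse_def)
qed

lemma collapse_on_wedge:
  assumes "v1 \<in> boundary M1 d1 z1" "v2 \<in> boundary M2 d2 z2" "v1 = X1.apex \<or> v2 = X2.apex"
  shows "collapse V (v1, v2) = V"
  using assms by (auto simp: collapse_def wedge_def)

lemma f_high_collapse:
  assumes "Y.high x"
  shows "f (Y.cls x) = collapse V (X1.cls (fst \<circ> x), X2.cls (snd \<circ> x))"
  using f_high[OF assms] collapse_off_wedge Y_high_projections(5,6)[OF assms] by simp

text \<open>For a sequence in \<open>Y\<close>, the condition of the case distinction is exactly
  that it is high.\<close>

lemma f_natural:
  assumes "Y.converges x"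
  shows "f (Y.cls x) =
    (if X1.converges (fst \<circ> x) \<and> X1.cls (fst \<circ> x) \<noteq> X1.apex \<and>
        X2.converges (snd \<circ> x) \<and> X2.cls (snd \<circ> x) \<noteq> X2.apex
     then collapse V (X1.cls (fst \<circ> x), X2.cls (snd \<circ> x)) else V)"
proof -
  have "range x \<subseteq> Y" using assms Y.converges_iff by blast
  then have high: "Y.high x \<longleftrightarrow> X1.converges (fst \<circ> x) \<and> X1.cls (fst \<circ> x) \<noteq> X1.apex \<and>
        X2.converges (snd \<circ> x) \<and> X2.cls (snd \<circ> x) \<noteq> X2.apex"
    unfolding Y_high_iff X1.high_iff X2.high_iff by blast
  show ?thesis
  proof (cases "Y.high x")
    case True
    then show ?thesis using f_high_collapse high by simp
  next
    case False
    then have apex: "Y.cls x = Y.apex"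
      using assms Y.cls_low Y.converges_iff_low_or_high by blast
    show ?thesis unfolding apex f_apex high[symmetric] using False by simp
  qed
qed

lemma boundary_Y_cases:
  assumes "w \<in> boundary Y dm z"
  obtains "w = Y.apex" | x where "Y.high x" "w = Y.cls x"
  using assms Y.high_cases by blast

lemma inj_on_f: "inj_on f (boundary Y dm z)"
proof (rule inj_onI)
  fix w w' assume w: "w \<in> boundary Y dm z" and w': "w' \<in> boundary Y dm z" and eq: "f w = f w'"
  have ne: "f (Y.cls x) \<noteq> V" if "Y.high x" for x
    using f_high[OF that] collapse_off_wedge(2) Y_high_projections(5,6)[OF that] by simp
  from w show "w = w'"
  proof (cases rule: boundary_Y_cases)
    case 1
    from w' show ?thesis
      by (cases rule: boundary_Y_cases) (use 1 eq ne f_apex in auto)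
  next
    case (2 x)
    note x = this
    from w' show ?thesis
    proof (cases rule: boundary_Y_cases)
      case 1
      then show ?thesis using x eq ne f_apex by auto
    next
      case (2 y)
      then have "f (Y.cls x) = f (Y.cls y)" using x eq by simp
      then show ?thesis
        using x 2 Y_cls_eq_iff[OF x(1) 2(1)] by (simp add: f_high)
    qed
  qed
qed

lemma off_wedge_cases:
  assumes "v1 \<in> boundary M1 d1 z1" "v2 \<in> boundary M2 d2 z2" "v1 \<noteq> X1.apex" "v2 \<noteq> X2.apex"
  obtains y where "Y.high y" "X1.cls (fst \<circ> y) = v1" "X2.cls (snd \<circ> y) = v2"
    "f (Y.cls y) = collapse V (v1, v2)" "Y.cls y \<in> boundary Y dm z"
proof -
  obtain x1 where x1: "X1.high x1" "v1 = X1.cls x1" using assms(1,3) by (rule X1.high_cases)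
  obtain x2 where x2: "X2.high x2" "v2 = X2.cls x2" using assms(2,4) by (rule X2.high_cases)
  obtain y where y: "Y.high y" "X1.cls (fst \<circ> y) = X1.cls x1" "X2.cls (snd \<circ> y) = X2.cls x2"
    using x1(1) x2(1) by (rule exists_Y_high)
  show thesis
    using y x1 x2 f_high_collapse[OF y(1)] Y.cls_in_boundary Y.high_iff by (intro that[of y]) auto
qed

lemma image_f: "f ` boundary Y dm z = collapse V ` (boundary M1 d1 z1 \<times> boundary M2 d2 z2)"
proof (intro equalityI subsetI)
  fix p assume "p \<in> f ` boundary Y dm z"
  then obtain w where w: "w \<in> boundary Y dm z" "p = f w" by blast
  from w(1) show "p \<in> collapse V ` (boundary M1 d1 z1 \<times> boundary M2 d2 z2)"
  proof (cases rule: boundary_Y_cases)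
    case 1
    have "collapse V (X1.apex, X2.apex) = V"
      using X1.apex_in_boundary X2.apex_in_boundary by (intro collapse_on_wedge) auto
    then have "p = collapse V (X1.apex, X2.apex)" using 1 w f_apex by simp
    then show ?thesis using X1.apex_in_boundary X2.apex_in_boundary by blast
  next
    case (2 x)
    then have "p = collapse V (X1.cls (fst \<circ> x), X2.cls (snd \<circ> x))" using w f_high_collapse by simp
    then show ?thesis using Y_high_projections(3,4)[OF 2(1)] by blast
  qed
next
  fix p assume "p \<in> collapse V ` (boundary M1 d1 z1 \<times> boundary M2 d2 z2)"
  then obtain v1 v2 where v: "v1 \<in> boundary M1 d1 z1" "v2 \<in> boundary M2 d2 z2" "p = collapse V (v1, v2)"
    by blast
  show "p \<in> f ` boundary Y dm z"
  proof (cases "v1 = X1.apex \<or> v2 = X2.apex")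
    case True
    then have "p = f Y.apex" using v collapse_on_wedge f_apex by simp
    then show ?thesis using Y.apex_in_boundary by blast
  next
    case False
    then obtain y where "f (Y.cls y) = collapse V (v1, v2)" "Y.cls y \<in> boundary Y dm z"
      using off_wedge_cases[OF v(1,2)] by metis
    then show ?thesis using v(3) by (metis image_eqI)
  qed
qed


section \<open>Neighbourhoods of boundary points of the product\<close>

lemma nhd_Y_high_imp:
  assumes x: "Y.high x"
  obtains s where "0 < s" "\<And>y. Y.converges y \<Longrightarrow> Y.cls y \<in> Y.nhd (Y.cls x) s \<Longrightarrow>
    Y.high y \<and> X1.cls (fst \<circ> y) \<in> X1.nhd (X1.cls (fst \<circ> x)) r \<and>
    X2.cls (snd \<circ> y) \<in> X2.nhd (X2.cls (snd \<circ> x)) r"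
proof -
  obtain c where c: "\<And>r y. c < r \<Longrightarrow> Y.converges y \<Longrightarrow> Y.cls y \<in> Y.nhd (Y.cls x) r \<Longrightarrow>
      Y.high y \<and> (\<exists>N. \<forall>i\<ge>N. \<forall>j\<ge>N. r - c \<le> HY (x i) (y j))"
    using x by (rule Y.H_ge_of_nhd_high) blast
  \<comment> \<open>The entries ensure in turn \<open>0 < s\<close>, \<open>c < s\<close>, and that
    \<open>s - c - \<Delta>\<close> exceeds \<open>r\<close> plus either base level, as
    \<open>nhd_high_of_H_ge\<close> asks in the factors.\<close>
  define s where "s = max 1 (max (c + 1) (c + \<Delta> + 1 + r + max (B1 z1) (B2 z2)))"
  have s: "0 < s" "c < s" "r + B1 z1 < s - c - \<Delta>" "r + B2 z2 < s - c - \<Delta>"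
    by (auto simp: s_def max_def)
  have "Y.high y \<and> X1.cls (fst \<circ> y) \<in> X1.nhd (X1.cls (fst \<circ> x)) r \<and>
      X2.cls (snd \<circ> y) \<in> X2.nhd (X2.cls (snd \<circ> x)) r"
    if y: "Y.converges y" "Y.cls y \<in> Y.nhd (Y.cls x) s" for y
  proof -
    from c[OF s(2) y] obtain N where y_high: "Y.high y"
      and N: "\<And>i j. i \<ge> N \<Longrightarrow> j \<ge> N \<Longrightarrow> s - c \<le> HY (x i) (y j)" by blast
    have r: "range x \<subseteq> Y" "range y \<subseteq> Y" using x y_high by (simp_all add: Y_high_iff)
    have "s - c - \<Delta> \<le> X1.H (fst (x i)) (fst (y j)) \<and> s - c - \<Delta> \<le> X2.H (snd (x i)) (snd (y j))"
      if "i \<ge> N" "j \<ge> N" for i j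
      using N[OF that] HY_approx[OF in_M(1)[OF r(1), of i] in_M(1)[OF r(2), of j]]
      by (auto simp: abs_le_iff min_def split: if_splits)
    then have "X1.cls (fst \<circ> y) \<in> X1.nhd (X1.cls (fst \<circ> x)) r"
        "X2.cls (snd \<circ> y) \<in> X2.nhd (X2.cls (snd \<circ> x)) r"
      using Y_high_projections[OF x] Y_high_projections[OF y_high]
        X1.nhd_high_of_H_ge[of "fst \<circ> x" "fst \<circ> y" r, OF _ _ s(3), of N]
        X2.nhd_high_of_H_ge[of "snd \<circ> x" "snd \<circ> y" r, OF _ _ s(4), of N] by auto
    then show ?thesis using y_high by blast
  qed
  with s(1) show thesis by (rule that)
qed

lemma nhd_Y_high_of:
  assumes x: "Y.high x"
  obtains s where "0 < s" "\<And>y. Y.high y \<Longrightarrow> X1.cls (fst \<circ> y) \<in> X1.nhd (X1.cls (fst \<circ> x)) s \<Longrightarrow>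
    X2.cls (snd \<circ> y) \<in> X2.nhd (X2.cls (snd \<circ> x)) s \<Longrightarrow> Y.cls y \<in> Y.nhd (Y.cls x) r"
proof -
  obtain c1 where c1: "\<And>r y. c1 < r \<Longrightarrow> X1.converges y \<Longrightarrow> X1.cls y \<in> X1.nhd (X1.cls (fst \<circ> x)) r \<Longrightarrow>
      X1.high y \<and> (\<exists>N. \<forall>i\<ge>N. \<forall>j\<ge>N. r - c1 \<le> X1.H ((fst \<circ> x) i) (y j))"
    using Y_high_projections(1)[OF x] by (rule X1.H_ge_of_nhd_high) blast
  obtain c2 where c2: "\<And>r y. c2 < r \<Longrightarrow> X2.converges y \<Longrightarrow> X2.cls y \<in> X2.nhd (X2.cls (snd \<circ> x)) r \<Longrightarrow>
      X2.high y \<and> (\<exists>N. \<forall>i\<ge>N. \<forall>j\<ge>N. r - c2 \<le> X2.H ((snd \<circ> x) i) (y j))"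
    using Y_high_projections(2)[OF x] by (rule X2.H_ge_of_nhd_high) blast
  define c where "c = max c1 c2"
  define s where "s = max 1 (max (c + 1) (c + \<Delta> + 1 + r + BY z))"
  have s: "0 < s" "c1 < s" "c2 < s" "r + BY z < s - c - \<Delta>"
    by (auto simp: s_def c_def)
  have "Y.cls y \<in> Y.nhd (Y.cls x) r"
    if y: "Y.high y" and y1: "X1.cls (fst \<circ> y) \<in> X1.nhd (X1.cls (fst \<circ> x)) s"
      and y2: "X2.cls (snd \<circ> y) \<in> X2.nhd (X2.cls (snd \<circ> x)) s" for y
  proof -
    have conv: "X1.converges (fst \<circ> y)" "X2.converges (snd \<circ> y)"
      using Y_high_projections[OF y] X1.high_iff X2.high_iff by auto
    obtain N1 where N1: "\<And>i j. i \<ge> N1 \<Longrightarrow> j \<ge> N1 \<Longrightarrow> s - c1 \<le> X1.H (fst (x i)) (fst (y j))"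
      using c1[OF s(2) conv(1) y1] by auto
    obtain N2 where N2: "\<And>i j. i \<ge> N2 \<Longrightarrow> j \<ge> N2 \<Longrightarrow> s - c2 \<le> X2.H (snd (x i)) (snd (y j))"
      using c2[OF s(3) conv(2) y2] by auto
    have r: "range x \<subseteq> Y" "range y \<subseteq> Y" using x y by (simp_all add: Y_high_iff)
    have "s - c - \<Delta> \<le> HY (x i) (y j)" if "i \<ge> max N1 N2" "j \<ge> max N1 N2" for i j
    proof -
      have "s - c \<le> X1.H (fst (x i)) (fst (y j))" "s - c \<le> X2.H (snd (x i)) (snd (y j))"
        using N1[of i j] N2[of i j] that by (auto simp: c_def)
      then show ?thesis
        using HY_approx[OF in_M(1)[OF r(1), of i] in_M(1)[OF r(2), of j]]
        by (auto simp: abs_le_iff min_def split: if_splits)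
    qed
    then show ?thesis using Y.nhd_high_of_H_ge[OF x y s(4)] by blast
  qed
  with s(1) show thesis by (rule that)
qed

text \<open>A small minimum means that at every late index one of the two coordinates is low. Which
  one may vary, but one of them is low infinitely often, and \<open>nhd_apex_of_H_le\<close> asks
  for no more.\<close>

lemma nhd_Y_apex_imp:
  obtains s where "0 < s" "\<And>y. Y.high y \<Longrightarrow> Y.cls y \<in> Y.nhd Y.apex s \<Longrightarrow>
    X1.cls (fst \<circ> y) \<in> X1.nhd X1.apex r \<or> X2.cls (snd \<circ> y) \<in> X2.nhd X2.apex r"
proof -
  \<comment> \<open>The term \<open>15 * \<Delta>\<close> is the error \<open>5 * C\<close> of
    \<open>H_le_of_nhd_apex\<close> at the constant \<open>3 * \<Delta>\<close> of the product;
    \<open>D\<close> pays for passing to coordinates.\<close>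
  define k where "k = BY z + 15 * \<Delta> + D"
  define s where "s = max 1 (max (r + 2 * C1 + k - B1 z1 + 1) (r + 2 * C2 + k - B2 z2 + 1))"
  have s: "0 < s" "r + 2 * C1 + (k - s) < B1 z1" "r + 2 * C2 + (k - s) < B2 z2"
    by (auto simp: s_def max_def)
  have "X1.cls (fst \<circ> y) \<in> X1.nhd X1.apex r \<or> X2.cls (snd \<circ> y) \<in> X2.nhd X2.apex r"
    if y: "Y.high y" "Y.cls y \<in> Y.nhd Y.apex s" for y
  proof -
    obtain N where N: "\<And>j. j \<ge> N \<Longrightarrow> HY (y j) z \<le> BY z + 5 * (3 * \<Delta>) - s"
      using Y.H_le_of_nhd_apex[OF y] by blast
    have r: "range y \<subseteq> Y" using y(1) by (simp add: Y_high_iff)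
    have or: "X1.H (fst (y j)) z1 \<le> k - s \<or> X2.H (snd (y j)) z2 \<le> k - s" if "j \<ge> N" for j
      using N[OF that] HY_base_approx[OF in_M(1)[OF r, of j]]
      by (auto simp: k_def abs_le_iff min_def split: if_splits)
    show ?thesis
    proof (cases "\<forall>N. \<exists>j\<ge>N. X1.H (fst (y j)) z1 \<le> k - s")
      case True
      then show ?thesis
        using X1.nhd_apex_of_H_le[OF Y_high_projections(1)[OF y(1)] _ s(2)] by simp
    next
      case False
      then obtain N' where "\<And>j. j \<ge> N' \<Longrightarrow> \<not> X1.H (fst (y j)) z1 \<le> k - s" by blast
      then have "\<exists>j\<ge>n. X2.H ((snd \<circ> y) j) z2 \<le> k - s" for n
        using or[of "max n (max N N')"] by (intro exI[of _ "max n (max N N')"]) auto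
      then show ?thesis
        using X2.nhd_apex_of_H_le[OF Y_high_projections(2)[OF y(1)] _ s(3)] by blast
    qed
  qed
  with s(1) show thesis by (rule that)
qed

text \<open>One low coordinate already makes the minimum low. This is why neighbourhoods of the
  collapsed point have to contain whole strips.\<close>

lemma nhd_Y_apex_of:
  obtains s where "0 < s" "\<And>y. Y.high y \<Longrightarrow>
    X1.cls (fst \<circ> y) \<in> X1.nhd X1.apex s \<or> X2.cls (snd \<circ> y) \<in> X2.nhd X2.apex s \<Longrightarrow>
    Y.cls y \<in> Y.nhd Y.apex r"
proof -
  define k where "k = max (B1 z1 + 5 * C1) (B2 z2 + 5 * C2) + D"
  define s where "s = max 1 (r + 2 * (3 * \<Delta>) + k - BY z + 1)"
  have s: "0 < s" "r + 2 * (3 * \<Delta>) + (k - s) < BY z"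
    by (auto simp: s_def)
  have "Y.cls y \<in> Y.nhd Y.apex r"
    if y: "Y.high y" and nhd: "X1.cls (fst \<circ> y) \<in> X1.nhd X1.apex s \<or>
      X2.cls (snd \<circ> y) \<in> X2.nhd X2.apex s" for y
  proof -
    have r: "range y \<subseteq> Y" using y by (simp add: Y_high_iff)
    have le: "HY (y j) z \<le> k - s" if "X1.H (fst (y j)) z1 \<le> B1 z1 + 5 * C1 - s \<or>
        X2.H (snd (y j)) z2 \<le> B2 z2 + 5 * C2 - s" for j
      using that HY_base_approx[OF in_M(1)[OF r, of j]]
      by (auto simp: k_def abs_le_iff min_def max_def split: if_splits)
    have "\<exists>N. \<forall>j\<ge>N. X1.H (fst (y j)) z1 \<le> B1 z1 + 5 * C1 - s \<or>
        X2.H (snd (y j)) z2 \<le> B2 z2 + 5 * C2 - s"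
      using nhd X1.H_le_of_nhd_apex[OF Y_high_projections(1)[OF y], of s]
        X2.H_le_of_nhd_apex[OF Y_high_projections(2)[OF y], of s] unfolding o_def by blast
    then obtain N where "\<And>j. j \<ge> N \<Longrightarrow> HY (y j) z \<le> k - s" using le by blast
    then have "\<exists>j\<ge>n. HY (y j) z \<le> k - s" for n
      by (intro exI[of _ "max n N"]) auto
    then show ?thesis using Y.nhd_apex_of_H_le[OF y _ s(2)] by blast
  qed
  with s(1) show thesis by (rule that)
qed


section \<open>The homeomorphism with the smashed product\<close>

abbreviation "T1 \<equiv> boundary_topology M1 d1 z1"
abbreviation "T2 \<equiv> boundary_topology M2 d2 z2"
abbreviation "TY \<equiv> boundary_topology Y dm z"

lemma openin_smash_iff:
  "openin (smash_product T1 X1.apex T2 X2.apex) U \<longleftrightarrow>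
    U \<subseteq> collapse V ` (boundary M1 d1 z1 \<times> boundary M2 d2 z2) \<and>
    openin (prod_topology T1 T2) {p \<in> boundary M1 d1 z1 \<times> boundary M2 d2 z2. collapse V p \<in> U} \<and>
    (V \<in> U \<longrightarrow> (\<exists>A B. openin T1 A \<and> X1.apex \<in> A \<and> openin T2 B \<and> X2.apex \<in> B \<and>
       collapse V ` (A \<times> boundary M2 d2 z2 \<union> boundary M1 d1 z1 \<times> B) \<subseteq> U))"
  by (simp add: openin_smash_product smash_quotient_def openin_quotient_topology)

text \<open>At the apex, \<open>nhd_Y_apex_imp\<close> lands in the strips that
  \<open>smash_product\<close> provides around the collapsed point; at high classes,
  \<open>nhd_Y_high_imp\<close> lands in a box of the product topology.\<close>

lemma openin_preimage_of_smash:
  assumes U: "openin (smash_product T1 X1.apex T2 X2.apex) U"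
  shows "openin TY {w \<in> boundary Y dm z. f w \<in> U}" (is "openin TY ?G")
proof -
  let ?P = "{p \<in> boundary M1 d1 z1 \<times> boundary M2 d2 z2. collapse V p \<in> U}"
  have P: "openin (prod_topology T1 T2) ?P"
    and wedge: "V \<in> U \<Longrightarrow> \<exists>A B. openin T1 A \<and> X1.apex \<in> A \<and> openin T2 B \<and> X2.apex \<in> B \<and>
       collapse V ` (A \<times> boundary M2 d2 z2 \<union> boundary M1 d1 z1 \<times> B) \<subseteq> U"
    using U unfolding openin_smash_iff by blast+
  have "\<exists>s>0. Y.nhd w s \<subseteq> ?G" if w: "w \<in> ?G" for w
  proof -
    from w have "w \<in> boundary Y dm z" "f w \<in> U" by auto
    from this(1) show ?thesis
    proof (cases rule: boundary_Y_cases)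
      case 1
      then have V: "V \<in> U" using \<open>f w \<in> U\<close> f_apex by simp
      obtain A B where AB: "openin T1 A" "X1.apex \<in> A" "openin T2 B" "X2.apex \<in> B"
        and sub: "collapse V ` (A \<times> boundary M2 d2 z2 \<union> boundary M1 d1 z1 \<times> B) \<subseteq> U"
        using wedge[OF V] by blast
      obtain r1 where r1: "X1.nhd X1.apex r1 \<subseteq> A"
        using AB(1,2) unfolding openin_boundary_topology by blast
      obtain r2 where r2: "X2.nhd X2.apex r2 \<subseteq> B"
        using AB(3,4) unfolding openin_boundary_topology by blast
      define r where "r = max r1 r2"
      have r: "X1.nhd X1.apex r \<subseteq> A" "X2.nhd X2.apex r \<subseteq> B"
        using r1 r2 boundary_nhd_antimono[of r1 r M1] boundary_nhd_antimono[of r2 r M2]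
        unfolding r_def by (meson max.cobounded1 max.cobounded2 order_trans)+
      obtain s where s: "0 < s" "\<And>y. Y.high y \<Longrightarrow> Y.cls y \<in> Y.nhd Y.apex s \<Longrightarrow>
          X1.cls (fst \<circ> y) \<in> X1.nhd X1.apex r \<or> X2.cls (snd \<circ> y) \<in> X2.nhd X2.apex r"
        by (rule nhd_Y_apex_imp[where r = r]) blast
      have "Y.nhd w s \<subseteq> ?G"
      proof
        fix w' assume w': "w' \<in> Y.nhd w s"
        then have bd: "w' \<in> boundary Y dm z" by (auto simp: boundary_nhd_def)
        then have "f w' \<in> U"
        proof (cases rule: boundary_Y_cases)
          case 1
          then show ?thesis using V f_apex by simp
        next
          case (2 y)
          then have "X1.cls (fst \<circ> y) \<in> A \<or> X2.cls (snd \<circ> y) \<in> B"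
            using s(2)[of y] w' \<open>w = Y.apex\<close> r by blast
          then show ?thesis
            using 2(2) f_high_collapse[OF 2(1)] Y_high_projections(3,4)[OF 2(1)] sub by blast
        qed
        then show "w' \<in> ?G" using bd by simp
      qed
      then show ?thesis using s(1) by blast
    next
      case (2 x)
      let ?v1 = "X1.cls (fst \<circ> x)" and ?v2 = "X2.cls (snd \<circ> x)"
      have "(?v1, ?v2) \<in> ?P"
        using 2 \<open>f w \<in> U\<close> f_high_collapse Y_high_projections(3,4) by simp
      then obtain A B where AB: "openin T1 A" "?v1 \<in> A" "openin T2 B" "?v2 \<in> B" and sub: "A \<times> B \<subseteq> ?P"
        using P unfolding openin_prod_topology_alt by meson
      obtain r1 where r1: "X1.nhd ?v1 r1 \<subseteq> A"
        using AB(1,2) unfolding openin_boundary_topology by blast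
      obtain r2 where r2: "X2.nhd ?v2 r2 \<subseteq> B"
        using AB(3,4) unfolding openin_boundary_topology by blast
      define r where "r = max r1 r2"
      have r: "X1.nhd ?v1 r \<subseteq> A" "X2.nhd ?v2 r \<subseteq> B"
        using r1 r2 boundary_nhd_antimono[of r1 r M1] boundary_nhd_antimono[of r2 r M2]
        unfolding r_def by (meson max.cobounded1 max.cobounded2 order_trans)+
      obtain s where s: "0 < s" "\<And>y. Y.converges y \<Longrightarrow> Y.cls y \<in> Y.nhd (Y.cls x) s \<Longrightarrow>
          Y.high y \<and> X1.cls (fst \<circ> y) \<in> X1.nhd ?v1 r \<and> X2.cls (snd \<circ> y) \<in> X2.nhd ?v2 r"
        by (rule nhd_Y_high_imp[OF 2(1), where r = r]) blast
      have "Y.nhd w s \<subseteq> ?G"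
      proof
        fix w' assume w': "w' \<in> Y.nhd w s"
        then have bd: "w' \<in> boundary Y dm z" by (auto simp: boundary_nhd_def)
        then obtain y where y: "Y.converges y" "w' = Y.cls y" by (rule Y.boundary_cases)
        then have y': "Y.high y" "(X1.cls (fst \<circ> y), X2.cls (snd \<circ> y)) \<in> A \<times> B"
          using s(2)[of y] w' 2(2) r by auto
        then have "f w' \<in> U"
          using y(2) f_high_collapse[OF y'(1)] sub by auto
        then show "w' \<in> ?G" using bd by simp
      qed
      then show ?thesis using s(1) by blast
    qed
  qed
  then show ?thesis unfolding openin_boundary_topology by blast
qed

text \<open>A pair off the wedge is the value of \<open>f\<close> at a high class by
  \<open>off_wedge_cases\<close>, so openness can be checked in the product, with
  \<open>nhd_Y_apex_of\<close> for the strips and \<open>nhd_Y_high_of\<close> for boxes off the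
  wedge.\<close>

lemma openin_smash_of_preimage:
  assumes U: "U \<subseteq> collapse V ` (boundary M1 d1 z1 \<times> boundary M2 d2 z2)"
    and G: "openin TY {w \<in> boundary Y dm z. f w \<in> U}" (is "openin TY ?G")
  shows "openin (smash_product T1 X1.apex T2 X2.apex) U"
proof -
  let ?P = "{p \<in> boundary M1 d1 z1 \<times> boundary M2 d2 z2. collapse V p \<in> U}"
  have apex: "\<exists>A B. openin T1 A \<and> X1.apex \<in> A \<and> openin T2 B \<and> X2.apex \<in> B \<and>
       collapse V ` (A \<times> boundary M2 d2 z2 \<union> boundary M1 d1 z1 \<times> B) \<subseteq> U" if V: "V \<in> U"
  proof -
    have "Y.apex \<in> ?G" using V f_apex Y.apex_in_boundary by simp
    then obtain r where r: "Y.nhd Y.apex r \<subseteq> ?G"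
      using G unfolding openin_boundary_topology by blast
    obtain s where s: "0 < s" "\<And>y. Y.high y \<Longrightarrow>
        X1.cls (fst \<circ> y) \<in> X1.nhd X1.apex s \<or> X2.cls (snd \<circ> y) \<in> X2.nhd X2.apex s \<Longrightarrow>
        Y.cls y \<in> Y.nhd Y.apex r"
      by (rule nhd_Y_apex_of[where r = r]) blast
    obtain A where A: "openin T1 A" "X1.apex \<in> A" "A \<subseteq> X1.nhd X1.apex s"
      using X1.apex_in_boundary by (rule X1.nhd_interior)
    obtain B where B: "openin T2 B" "X2.apex \<in> B" "B \<subseteq> X2.nhd X2.apex s"
      using X2.apex_in_boundary by (rule X2.nhd_interior)
    have "collapse V (v1, v2) \<in> U"
      if v: "(v1, v2) \<in> A \<times> boundary M2 d2 z2 \<union> boundary M1 d1 z1 \<times> B" for v1 v2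
    proof -
      have bd: "v1 \<in> boundary M1 d1 z1" "v2 \<in> boundary M2 d2 z2"
        using v A(1) B(1) unfolding openin_boundary_topology by auto
      show ?thesis
      proof (cases "v1 = X1.apex \<or> v2 = X2.apex")
        case True
        then show ?thesis using collapse_on_wedge[OF bd] V by simp
      next
        case False
        then obtain y where y: "Y.high y" "X1.cls (fst \<circ> y) = v1" "X2.cls (snd \<circ> y) = v2"
            "f (Y.cls y) = collapse V (v1, v2)"
          using off_wedge_cases[OF bd] by metis
        have "v1 \<in> X1.nhd X1.apex s \<or> v2 \<in> X2.nhd X2.apex s" using v A(3) B(3) by blast
        then have "Y.cls y \<in> ?G" using s(2)[OF y(1)] y r by blast
        then show ?thesis using y(4) by simp
      qed
    qed
    then have "collapse V ` (A \<times> boundary M2 d2 z2 \<union> boundary M1 d1 z1 \<times> B) \<subseteq> U"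
      by (intro image_subsetI) (metis surj_pair)
    with A(1,2) B(1,2) show ?thesis by blast
  qed
  have "\<exists>A B. openin T1 A \<and> openin T2 B \<and> v1 \<in> A \<and> v2 \<in> B \<and> A \<times> B \<subseteq> ?P" if v: "(v1, v2) \<in> ?P" for v1 v2
  proof -
    have bd: "v1 \<in> boundary M1 d1 z1" "v2 \<in> boundary M2 d2 z2" and vU: "collapse V (v1, v2) \<in> U"
      using v by auto
    show ?thesis
    proof (cases "v1 = X1.apex \<or> v2 = X2.apex")
      case True
      then have "V \<in> U" using vU collapse_on_wedge[OF bd] by simp
      then obtain A B where AB: "openin T1 A" "X1.apex \<in> A" "openin T2 B" "X2.apex \<in> B"
        and sub: "collapse V ` (A \<times> boundary M2 d2 z2 \<union> boundary M1 d1 z1 \<times> B) \<subseteq> U"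
        using apex by blast
      have AB_bd: "A \<subseteq> boundary M1 d1 z1" "B \<subseteq> boundary M2 d2 z2"
        using AB unfolding openin_boundary_topology by blast+
      have whole: "openin T1 (boundary M1 d1 z1)" "openin T2 (boundary M2 d2 z2)"
        by (metis openin_topspace topspace_boundary_topology)+
      \<comment> \<open>At a point of the wedge, one of the two strips is already an open box inside
        the preimage.\<close>
      have strips: "A \<times> boundary M2 d2 z2 \<subseteq> ?P" "boundary M1 d1 z1 \<times> B \<subseteq> ?P"
        using sub AB_bd by auto
      from True show ?thesis
      proof
        assume "v1 = X1.apex"
        then have "v1 \<in> A" using AB(2) by simp
        with AB(1) whole(2) strips(1) bd(2) show ?thesis by (intro exI conjI)
      next
        assume "v2 = X2.apex"
        then have "v2 \<in> B" using AB(4) by simp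
        with AB(3) whole(1) strips(2) bd(1) show ?thesis by (intro exI conjI)
      qed
    next
      case False
      then obtain x where x: "Y.high x" "X1.cls (fst \<circ> x) = v1" "X2.cls (snd \<circ> x) = v2"
          "f (Y.cls x) = collapse V (v1, v2)" "Y.cls x \<in> boundary Y dm z"
        using off_wedge_cases[OF bd] by metis
      then have "Y.cls x \<in> ?G" using vU by simp
      then obtain r where r: "Y.nhd (Y.cls x) r \<subseteq> ?G"
        using G unfolding openin_boundary_topology by blast
      obtain s where s: "0 < s" "\<And>y. Y.high y \<Longrightarrow> X1.cls (fst \<circ> y) \<in> X1.nhd v1 s \<Longrightarrow>
          X2.cls (snd \<circ> y) \<in> X2.nhd v2 s \<Longrightarrow> Y.cls y \<in> Y.nhd (Y.cls x) r"
        using nhd_Y_high_of[OF x(1), where r = r] unfolding x(2,3) by blast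
      \<comment> \<open>The box is shrunk off the wedge, so that every pair in it comes from a high
        class of the product.\<close>
      obtain s1 where s1: "X1.apex \<notin> X1.nhd v1 s1"
        using X1.nhd_avoids_apex[OF Y_high_projections(1)[OF x(1)]] x(2) by metis
      obtain s2 where s2: "X2.apex \<notin> X2.nhd v2 s2"
        using X2.nhd_avoids_apex[OF Y_high_projections(2)[OF x(1)]] x(3) by metis
      obtain A where A: "openin T1 A" "v1 \<in> A" "A \<subseteq> X1.nhd v1 (max s s1)"
        using bd(1) by (rule X1.nhd_interior)
      obtain B where B: "openin T2 B" "v2 \<in> B" "B \<subseteq> X2.nhd v2 (max s s2)"
        using bd(2) by (rule X2.nhd_interior)
      have A': "A \<subseteq> X1.nhd v1 s" "X1.apex \<notin> A"
        using A(3) s1 boundary_nhd_antimono[of s "max s s1" M1 d1 z1 v1]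
          boundary_nhd_antimono[of s1 "max s s1" M1 d1 z1 v1] by auto
      have B': "B \<subseteq> X2.nhd v2 s" "X2.apex \<notin> B"
        using B(3) s2 boundary_nhd_antimono[of s "max s s2" M2 d2 z2 v2]
          boundary_nhd_antimono[of s2 "max s s2" M2 d2 z2 v2] by auto
      have AB_bd: "A \<subseteq> boundary M1 d1 z1" "B \<subseteq> boundary M2 d2 z2"
        using A(1) B(1) unfolding openin_boundary_topology by blast+
      have "collapse V (w1, w2) \<in> U" if w: "w1 \<in> A" "w2 \<in> B" for w1 w2
      proof -
        have "w1 \<noteq> X1.apex" "w2 \<noteq> X2.apex" using w A'(2) B'(2) by blast+
        then obtain y where y: "Y.high y" "X1.cls (fst \<circ> y) = w1" "X2.cls (snd \<circ> y) = w2"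
            "f (Y.cls y) = collapse V (w1, w2)"
          using off_wedge_cases[of w1 w2] w AB_bd by (metis subsetD)
        then have "Y.cls y \<in> ?G" using s(2)[OF y(1)] w A'(1) B'(1) r by blast
        then show ?thesis using y(4) by simp
      qed
      then have "A \<times> B \<subseteq> ?P" using AB_bd by auto
      then show ?thesis using A(1,2) B(1,2) by blast
    qed
  qed
  then have "openin (prod_topology T1 T2) ?P"
    unfolding openin_prod_topology_alt by blast
  then show ?thesis
    unfolding openin_smash_iff using U apex by blast
qed

lemma homeomorphic_map_f: "homeomorphic_map TY (smash_product T1 X1.apex T2 X2.apex) f"
proof -
  have top: "topspace (smash_product T1 X1.apex T2 X2.apex) =
      collapse V ` (boundary M1 d1 z1 \<times> boundary M2 d2 z2)"
    using topspace_smash_product[of X1.apex T1 X2.apex T2] X1.apex_in_boundary X2.apex_in_boundary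
    by simp
  have "quotient_map TY (smash_product T1 X1.apex T2 X2.apex) f"
    unfolding quotient_map_def top topspace_boundary_topology
    using image_f openin_preimage_of_smash openin_smash_of_preimage by blast
  then show ?thesis
    using inj_on_f by (simp add: homeomorphic_map_def)
qed

end

section \<open>From rays to horospherical spaces, and the theorem\<close>

lemma apex_eq_limit_of_ray:
  assumes "based_horospherical M d (busemann d \<gamma>) C z" and "busemann_ray M d \<gamma> k"
    and u: "ray_converges_to M d z \<gamma> u"
  shows "u = based_horospherical.apex M d (busemann d \<gamma>) z"
proof -
  interpret X: based_horospherical M d "busemann d \<gamma>" C z by fact
  interpret R: busemann_ray M d \<gamma> k by fact
  \<comment> \<open>\<open>H\<close> is at most \<open>B\<close> at the point of the ray, and
    \<open>busemann_le\<close> at time \<open>i\<close>, where the distance is 0, bounds this by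
    \<open>k + 1 - i\<close>. Hence the ray is low.\<close>
  have "X.H (\<gamma> (real i)) z \<le> k + 1 - real i" for i
    using X.H_le(1)[of "\<gamma> (real i)" z] R.busemann_le[of "\<gamma> (real i)" "real i"]
      R.ray_in[of "real i"] X.z by simp
  then have "X.H (\<gamma> (real i)) z \<le> K" if "i \<ge> nat \<lceil>k + 1 - K\<rceil>" for i K
    using that by (smt (verit) real_nat_ceiling_ge of_nat_mono)
  then have "\<exists>N. \<forall>i\<ge>N. X.H (\<gamma> (real i)) z \<le> K" for K by blast
  then have "X.low (\<lambda>i. \<gamma> (real i))"
    unfolding X.low_def using R.ray_in by auto
  then show ?thesis
    using u X.cls_low by (simp add: ray_converges_to_def represents_def)
qed

lemma horospherical_of_ray:
  assumes "Metric_space M d" "roughly_geodesic M d" "gromov_hyperbolic M d"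
    "rough_geodesic_ray M d \<gamma>" "z \<in> M" "ray_converges_to M d z \<gamma> u"
  obtains C where "based_horospherical M d (busemann d \<gamma>) C z"
    "u = based_horospherical.apex M d (busemann d \<gamma>) z"
proof -
  obtain k where "0 \<le> k" "rough_isometric_on M d k {0..} \<gamma>"
    using assms(4) unfolding rough_geodesic_ray_def by blast
  then have ray: "busemann_ray M d \<gamma> k"
    by (intro busemann_ray.intro busemann_ray_axioms.intro assms(1))
  obtain C where "horospherical M d (busemann d \<gamma>) C"
    using busemann_ray.horospherical_busemann[OF ray assms(2,3)] by blast
  then have "based_horospherical M d (busemann d \<gamma>) C z"
    by (intro based_horospherical.intro based_horospherical_axioms.intro assms(5))
  then show thesis using that apex_eq_limit_of_ray[OF _ ray assms(6)] by blast
qed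

theorem theorem4:
  fixes M1 :: "'a set" and d1 :: "'a \<Rightarrow> 'a \<Rightarrow> real"
    and M2 :: "'b set" and d2 :: "'b \<Rightarrow> 'b \<Rightarrow> real"
    and z1 :: 'a and z2 :: 'b
    and u1 :: "(nat \<Rightarrow> 'a) set" and u2 :: "(nat \<Rightarrow> 'b) set"
    and \<gamma>1 :: "real \<Rightarrow> 'a" and \<gamma>2 :: "real \<Rightarrow> 'b"
  assumes "Metric_space M1 d1" and "Metric_space M2 d2"
    and "roughly_geodesic M1 d1" and "roughly_geodesic M2 d2"
    and "gromov_hyperbolic M1 d1" and "gromov_hyperbolic M2 d2"
    and "z1 \<in> M1" and "z2 \<in> M2"
    and "boundary M1 d1 z1 \<noteq> {}" and "boundary M2 d2 z2 \<noteq> {}"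
    and "u1 \<in> boundary M1 d1 z1" and "u2 \<in> boundary M2 d2 z2"
    and "rough_geodesic_ray M1 d1 \<gamma>1" and "ray_converges_to M1 d1 z1 \<gamma>1 u1"
    and "rough_geodesic_ray M2 d2 \<gamma>2" and "ray_converges_to M2 d2 z2 \<gamma>2 u2"
  defines "Y \<equiv> busemann_product M1 d1 \<gamma>1 M2 d2 \<gamma>2"
    and "dm \<equiv> max_dist d1 d2"
    and "T1 \<equiv> boundary_topology M1 d1 z1"
    and "T2 \<equiv> boundary_topology M2 d2 z2"
    and "V \<equiv> wedge (boundary M1 d1 z1) u1 (boundary M2 d2 z2) u2"
  shows "\<exists>\<Delta>\<^sub>0\<ge>0. \<forall>\<Delta>\<ge>\<Delta>\<^sub>0.
    Y \<Delta> \<noteq> {} \<and> roughly_geodesic (Y \<Delta>) dm \<and> gromov_hyperbolic (Y \<Delta>) dm \<and>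
    (\<forall>z\<in>Y \<Delta>. \<exists>f.
      (\<forall>x. converges_to_infinity (Y \<Delta>) dm z x \<longrightarrow>
        (let x1 = fst \<circ> x; x2 = snd \<circ> x;
             v1 = boundary_class M1 d1 z1 x1; v2 = boundary_class M2 d2 z2 x2
         in f (boundary_class (Y \<Delta>) dm z x) =
            (if converges_to_infinity M1 d1 z1 x1 \<and> v1 \<noteq> u1 \<and>
                converges_to_infinity M2 d2 z2 x2 \<and> v2 \<noteq> u2
             then collapse V (v1, v2) else V))) \<and>
      homeomorphic_map (boundary_topology (Y \<Delta>) dm z) (smash_product T1 u1 T2 u2) f \<and>
      (compact_space T1 \<and> compact_space T2 \<longrightarrow>
        homeomorphic_map (boundary_topology (Y \<Delta>) dm z) (smash_quotient T1 u1 T2 u2) f))"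
proof -
  obtain C1 where X1: "based_horospherical M1 d1 (busemann d1 \<gamma>1) C1 z1"
    and u1: "u1 = based_horospherical.apex M1 d1 (busemann d1 \<gamma>1) z1"
    using assms(1,3,5,13,7,14) by (rule horospherical_of_ray)
  obtain C2 where X2: "based_horospherical M2 d2 (busemann d2 \<gamma>2) C2 z2"
    and u2: "u2 = based_horospherical.apex M2 d2 (busemann d2 \<gamma>2) z2"
    using assms(2,4,6,15,8,16) by (rule horospherical_of_ray)
  have "0 \<le> C1 + C2"
    using horospherical.C_nonneg[OF based_horospherical.axioms(1)[OF X1]]
      horospherical.C_nonneg[OF based_horospherical.axioms(1)[OF X2]] by simp
  show ?thesis
  \<comment> \<open>The threshold is the condition of \<open>busemann_pair\<close>. It depends on
    the factors only, and the base point \<open>z\<close> of the product stays arbitrary.\<close>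
  proof (rule exI[of _ "C1 + C2"], intro conjI allI impI ballI)
    show "0 \<le> C1 + C2" by fact
    fix \<Delta> assume "C1 + C2 \<le> \<Delta>"
    then interpret P: busemann_pair M1 d1 \<gamma>1 C1 z1 M2 d2 \<gamma>2 C2 z2 \<Delta>
      by (intro busemann_pair.intro X1 X2 busemann_pair_axioms.intro)
    show "Y \<Delta> \<noteq> {}" unfolding Y_def by (rule P.Y_nonempty)
    show "roughly_geodesic (Y \<Delta>) dm" unfolding Y_def dm_def
      by (rule horospherical.roughly_geodesic[OF P.horospherical_Y])
    show "gromov_hyperbolic (Y \<Delta>) dm" unfolding Y_def dm_def
      by (rule horospherical.gromov_hyperbolic[OF P.horospherical_Y])
    fix z assume "z \<in> Y \<Delta>"
    then interpret Q: based_busemann_pair M1 d1 \<gamma>1 C1 z1 M2 d2 \<gamma>2 C2 z2 \<Delta> z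
      unfolding Y_def by unfold_locales
    have homeo: "homeomorphic_map (boundary_topology (Y \<Delta>) dm z) (smash_product T1 u1 T2 u2) Q.f"
      unfolding Y_def dm_def T1_def T2_def u1 u2 by (rule Q.homeomorphic_map_f)
    have natural: "Q.f (boundary_class (Y \<Delta>) dm z x) =
        (if converges_to_infinity M1 d1 z1 (fst \<circ> x) \<and> boundary_class M1 d1 z1 (fst \<circ> x) \<noteq> u1 \<and>
            converges_to_infinity M2 d2 z2 (snd \<circ> x) \<and> boundary_class M2 d2 z2 (snd \<circ> x) \<noteq> u2
         then collapse V (boundary_class M1 d1 z1 (fst \<circ> x), boundary_class M2 d2 z2 (snd \<circ> x)) else V)"
      if "converges_to_infinity (Y \<Delta>) dm z x" for x
      using that unfolding Y_def dm_def V_def u1 u2 by (rule Q.f_natural)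
    have quotient: "smash_product T1 u1 T2 u2 = smash_quotient T1 u1 T2 u2"
      if "compact_space T1 \<and> compact_space T2"
      using that assms(11,12) by (intro smash_product_eq_quotient) (auto simp: T1_def T2_def)
    show "\<exists>f.
      (\<forall>x. converges_to_infinity (Y \<Delta>) dm z x \<longrightarrow>
        (let x1 = fst \<circ> x; x2 = snd \<circ> x;
             v1 = boundary_class M1 d1 z1 x1; v2 = boundary_class M2 d2 z2 x2
         in f (boundary_class (Y \<Delta>) dm z x) =
            (if converges_to_infinity M1 d1 z1 x1 \<and> v1 \<noteq> u1 \<and>
                converges_to_infinity M2 d2 z2 x2 \<and> v2 \<noteq> u2
             then collapse V (v1, v2) else V))) \<and>
      homeomorphic_map (boundary_topology (Y \<Delta>) dm z) (smash_product T1 u1 T2 u2) f \<and>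
      (compact_space T1 \<and> compact_space T2 \<longrightarrow>
        homeomorphic_map (boundary_topology (Y \<Delta>) dm z) (smash_quotient T1 u1 T2 u2) f)"
      unfolding Let_def using natural homeo quotient by (intro exI[of _ Q.f]) auto
  qed
qed

end
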